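(* For $T\in\mathscr C$ and $Z\in\mathfrak g_2$, the function $\mathcal R_{30}(T,Z)$ is nonnegative, homogeneous of degree thirty in $Z$, and satisfies $$\mathcal R_{30}(T,Z)=0\quad\Longleftrightarrow\quad\operatorname{Lie}\{Z,TZT\}\text{ acts reducibly on }V.$$ It is polynomial in the entries of $(T,Z)$ on $\mathscr C\times\mathfrak g_2$ (i.e. the restriction of a real polynomial in the matrix entries). Moreover $$\mathcal R_{30}(T,Z)=\det{}_{\mathscr S_0}\bigl(\Pi_T^- -\Pi_T^+\mathsf A_Z^2\Pi_T^+\bigr).$$ Both formulas for $\mathcal R_{30}$ are invariant under simultaneous orthogonal conjugation $(T,Z)\mapsto(gTg^{-1},gZg^{-1})$, $g\in O(V)$, of the matrix data.
   Context: $\mathbb O$ is the real octonion division algebra with its standard Euclidean inner product and $V=\operatorname{Im}\mathbb O\cong\mathbb R^7$. $G_2=\operatorname{Aut}(\mathbb O)\subset SO(V)$, $\mathfrak g_2=\operatorname{Der}(\mathbb O)\subset\mathfrak{so}(V)$ via the faithful action on $V$. A quaternionic context is a unital subalgebra $H\subset\mathbb O$ isomorphic to the quaternions; the quaternionic reflection $\sigma_H\in G_2$ is $+1$ on $H$ and $-1$ on $H^\perp$; $\mathscr C=\{\sigma_H\}=\{T\in G_2:T^2=I,\operatorname{tr}_VT=-1\}$. $\operatorname{Lie}\{U,W\}$ is the smallest real Lie subalgebra containing $U,W$. Reducible means having a nonzero proper invariant real subspace. Frobenius inner product: $\langle U,W\rangle_F=\operatorname{tr}(U^{\mathsf T}W)$.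 $\mathscr S_0=\{Q\in\operatorname{End}(V):Q^{\mathsf T}=Q,\operatorname{tr}Q=0\}$ (dimension $27$), $\mathscr E_T=\{Q\in\mathscr S_0:TQT=Q\}$ (dimension $15$). For any Frobenius-orthonormal basis $Q_1,\dots,Q_{15}$ of $\mathscr E_T$, $$\mathcal R_{30}(T,Z)=\det\bigl(\langle[Z,Q_i],[Z,Q_j]\rangle_F\bigr)_{i,j=1}^{15},$$ which does not depend on the choice of orthonormal basis. On $\mathscr S_0$ define the operators $\Pi_T^\pm(Q)=\tfrac12(Q\pm TQT)$ and $\mathsf A_Z(Q)=[Z,Q]=ZQ-QZ$; $\det_{\mathscr S_0}$ is the determinant of an endomorphism of $\mathscr S_0$. *)

theory Defs
  imports "HOL-Analysis.Analysis"
begin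

section \<open>Quaternions and octonions\<close>

text \<open>
  Both algebras are modelled as \<open>\<real> \<oplus> Im\<close> with product
  \<open>(a, u)(b, v) = (a b - u \<bullet> v, a v + b u + u \<times> v)\<close>, where \<open>\<times>\<close> is the vector product on the
  imaginary part.  The product type carries the standard Euclidean inner product.
\<close>

definition im_mult ::
  "('v::real_inner \<Rightarrow> 'v \<Rightarrow> 'v) \<Rightarrow> real \<times> 'v \<Rightarrow> real \<times> 'v \<Rightarrow> real \<times> 'v" where
  "im_mult X x y =
     (fst x * fst y - inner (snd x) (snd y),
      fst x *\<^sub>R snd y + fst y *\<^sub>R snd x + X (snd x) (snd y))"

type_synonym quaternion = "real \<times> (real^3)"
type_synonym octonion = "real \<times> (real^7)"
type_synonym mat7 = "real^7^7"

text \<open>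
  The seven-dimensional cross product with the cyclic multiplication table
  \<open>e\<^sub>i e\<^sub>i\<^sub>+\<^sub>1 = e\<^sub>i\<^sub>+\<^sub>3\<close> (together with its cyclic rotations
  \<open>e\<^sub>i\<^sub>+\<^sub>1 e\<^sub>i\<^sub>+\<^sub>3 = e\<^sub>i\<close> and \<open>e\<^sub>i\<^sub>+\<^sub>3 e\<^sub>i = e\<^sub>i\<^sub>+\<^sub>1\<close>).
  The index type \<open>7\<close> is the ring of integers modulo 7, so index arithmetic is modulo 7.
\<close>

definition cross7 :: "real^7 \<Rightarrow> real^7 \<Rightarrow> real^7" where
  "cross7 u v = (\<chi> k.
       (u $ (k - 3) * v $ (k - 2) - u $ (k - 2) * v $ (k - 3))
     + (u $ (k + 1) * v $ (k + 3) - u $ (k + 3) * v $ (k + 1))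
     + (u $ (k + 2) * v $ (k - 1) - u $ (k - 1) * v $ (k + 2)))"

definition quat_mult :: "quaternion \<Rightarrow> quaternion \<Rightarrow> quaternion" where
  "quat_mult = im_mult cross3"

definition oct_mult :: "octonion \<Rightarrow> octonion \<Rightarrow> octonion" (infixl \<open>\<star>\<close> 70) where
  "oct_mult = im_mult cross7"

definition oct_one :: octonion where
  "oct_one = (1, 0)"

section \<open>Derivations and quaternionic reflections as matrices on \<open>Im \<O>\<close>\<close>

text \<open>\<open>V = Im \<O> = {0} \<times> \<real>\<^sup>7\<close> is identified with \<open>\<real>\<^sup>7\<close>, and \<open>End(V)\<close> with the \<open>7 \<times> 7\<close> matrices.\<close>

definition acts_on_Im :: "(octonion \<Rightarrow> octonion) \<Rightarrow> mat7 \<Rightarrow> bool" where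
  "acts_on_Im f A \<longleftrightarrow> (\<forall>v. f (0, v) = (0, A *v v))"

definition octonion_derivation :: "(octonion \<Rightarrow> octonion) \<Rightarrow> bool" where
  "octonion_derivation D \<longleftrightarrow> linear D \<and> (\<forall>x y. D (x \<star> y) = D x \<star> y + x \<star> D y)"

definition g2 :: "mat7 set" where
  "g2 = {A. \<exists>D. octonion_derivation D \<and> acts_on_Im D A}"

definition quaternionic_context :: "octonion set \<Rightarrow> bool" where
  "quaternionic_context H \<longleftrightarrow>
     subspace H \<and> oct_one \<in> H \<and> (\<forall>x\<in>H. \<forall>y\<in>H. x \<star> y \<in> H) \<and>
     (\<exists>\<phi> :: quaternion \<Rightarrow> octonion.
        linear \<phi> \<and> bij_betw \<phi> UNIV H \<and> (\<forall>p q. \<phi> (quat_mult p q) = \<phi> p \<star> \<phi> q))"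

definition is_quaternionic_reflection :: "octonion set \<Rightarrow> (octonion \<Rightarrow> octonion) \<Rightarrow> bool" where
  "is_quaternionic_reflection H \<sigma> \<longleftrightarrow>
     linear \<sigma> \<and> (\<forall>x\<in>H. \<sigma> x = x) \<and> (\<forall>x\<in>H\<^sup>\<bottom>. \<sigma> x = - x)"

definition quaternionic_reflections :: "mat7 set" (\<open>\<C>\<close>) where
  "\<C> = {T. \<exists>H \<sigma>. quaternionic_context H \<and> is_quaternionic_reflection H \<sigma> \<and> acts_on_Im \<sigma> T}"

section \<open>Lie subalgebras and reducibility\<close>

definition comm :: "mat7 \<Rightarrow> mat7 \<Rightarrow> mat7" where
  "comm A B = A ** B - B ** A"

definition lie_subalgebra :: "mat7 set \<Rightarrow> bool" where
  "lie_subalgebra L \<longleftrightarrow> subspace L \<and> (\<forall>A\<in>L. \<forall>B\<in>L. comm A B \<in> L)"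

definition Lie :: "mat7 set \<Rightarrow> mat7 set" where
  "Lie S = lie_subalgebra hull S"

definition acts_reducibly :: "mat7 set \<Rightarrow> bool" where
  "acts_reducibly L \<longleftrightarrow>
     (\<exists>W :: (real^7) set. subspace W \<and> W \<noteq> {0} \<and> W \<noteq> UNIV \<and> (\<forall>A\<in>L. \<forall>w\<in>W. A *v w \<in> W))"

section \<open>The function \<open>\<R>\<^sub>3\<^sub>0\<close>\<close>

definition frob :: "mat7 \<Rightarrow> mat7 \<Rightarrow> real" where
  "frob U W = trace (transpose U ** W)"

definition S0 :: "mat7 set" where
  "S0 = {Q. transpose Q = Q \<and> trace Q = 0}"

definition E_space :: "mat7 \<Rightarrow> mat7 set" where
  "E_space T = {Q \<in> S0. T ** Q ** T = Q}"

definition frob_onb :: "('n::finite \<Rightarrow> mat7) \<Rightarrow> mat7 set \<Rightarrow> bool" where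
  "frob_onb Q S \<longleftrightarrow> (\<forall>i j. frob (Q i) (Q j) = (if i = j then 1 else 0)) \<and> span (range Q) = S"

definition gram :: "mat7 \<Rightarrow> ('n::finite \<Rightarrow> mat7) \<Rightarrow> real^'n^'n" where
  "gram Z Q = (\<chi> i j. frob (comm Z (Q i)) (comm Z (Q j)))"

text \<open>The value does not depend on the chosen orthonormal basis: see \<open>R30_eq\<close> below.\<close>

definition R30 :: "mat7 \<Rightarrow> mat7 \<Rightarrow> real" where
  "R30 T Z = det (gram Z (SOME Q :: 15 \<Rightarrow> mat7. frob_onb Q (E_space T)))"

section \<open>The determinant on \<open>\<S>\<^sub>0\<close>\<close>

definition is_basis :: "('n::finite \<Rightarrow> 'v::real_vector) \<Rightarrow> 'v set \<Rightarrow> bool" where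
  "is_basis B S \<longleftrightarrow> inj B \<and> independent (range B) \<and> span (range B) = S"

text \<open>Column \<open>j\<close> holds the coordinates of \<open>f (B j)\<close> with respect to the basis \<open>B\<close>.\<close>

definition matrix_wrt ::
  "('n::finite \<Rightarrow> 'v::real_vector) \<Rightarrow> ('v \<Rightarrow> 'v) \<Rightarrow> real^'n^'n" where
  "matrix_wrt B f = (\<chi> i j. representation (range B) (f (B j)) (B i))"

text \<open>The index type has \<open>dim S0 = 27\<close> elements.  For operators preserving \<open>S0\<close> the value does
  not depend on the chosen basis: see \<open>det_S0_eq\<close> below.\<close>

definition det_S0 :: "(mat7 \<Rightarrow> mat7) \<Rightarrow> real" where
  "det_S0 f = det (matrix_wrt (SOME B :: 27 \<Rightarrow> mat7. is_basis B S0) f)"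

definition Pi_plus :: "mat7 \<Rightarrow> mat7 \<Rightarrow> mat7" where
  "Pi_plus T Q = (1/2) *\<^sub>R (Q + T ** Q ** T)"

definition Pi_minus :: "mat7 \<Rightarrow> mat7 \<Rightarrow> mat7" where
  "Pi_minus T Q = (1/2) *\<^sub>R (Q - T ** Q ** T)"

text \<open>The operator \<open>\<Pi>\<^sub>T\<^sup>- - \<Pi>\<^sub>T\<^sup>+ A\<^sub>Z\<^sup>2 \<Pi>\<^sub>T\<^sup>+\<close>, where \<open>A\<^sub>Z = comm Z\<close>.\<close>

definition R30_operator :: "mat7 \<Rightarrow> mat7 \<Rightarrow> mat7 \<Rightarrow> mat7" where
  "R30_operator T Z Q = Pi_minus T Q - Pi_plus T (comm Z (comm Z (Pi_plus T Q)))"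

section \<open>Independence of the chosen bases\<close>

lemma frob_inner: "frob U W = inner U W"
  unfolding frob_def trace_def matrix_matrix_mult_def transpose_def inner_vec_def
  by simp (rule sum.swap)

lemma frob_onb_expand:
  assumes Q: "frob_onb (Q :: 'n::finite \<Rightarrow> mat7) S" and x: "x \<in> S"
  shows "x = (\<Sum>i\<in>UNIV. inner (Q i) x *\<^sub>R Q i)"
proof -
  have on: "inner (Q i) (Q j) = (if i = j then 1 else 0)" for i j
    using Q by (simp add: frob_onb_def frob_inner)
  have "x \<in> span (range Q)"
    using Q x by (simp add: frob_onb_def)
  then show ?thesis
  proof (induction rule: span_induct_alt)
    case base
    show ?case by simp
  next
    case (step c y z)
    then obtain k where [simp]: "y = Q k" by auto
    have "(\<Sum>i\<in>UNIV. inner (Q i) (c *\<^sub>R y + z) *\<^sub>R Q i)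
        = (\<Sum>i\<in>UNIV. (if i = k then c *\<^sub>R Q i else 0)) + (\<Sum>i\<in>UNIV. inner (Q i) z *\<^sub>R Q i)"
      unfolding sum.distrib[symmetric]
      by (rule sum.cong) (auto simp: inner_add_right on scaleR_add_left)
    then show ?case using step by simp
  qed
qed

lemma comm_sum: "comm Z (\<Sum>i\<in>I. c i *\<^sub>R Q i) = (\<Sum>i\<in>I. c i *\<^sub>R comm Z (Q i))"
proof -
  have lin: "linear (comm Z)"
    by (rule linearI)
      (simp_all add: comm_def vec_eq_iff matrix_matrix_mult_def sum.distrib sum_distrib_left
        algebra_simps)
  show ?thesis
    by (simp add: linear_sum[OF lin] linear_cmul[OF lin])
qed

lemma det_gram_unique:
  assumes P: "frob_onb (P :: 'n::finite \<Rightarrow> mat7) S" and Q: "frob_onb (Q :: 'n \<Rightarrow> mat7) S"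
  shows "det (gram Z P) = det (gram Z Q)"
proof -
  define M :: "real^'n^'n" where "M = (\<chi> i j. inner (Q i) (P j))"
  have inS: "P j \<in> S" "Q j \<in> S" for j
    using P Q unfolding frob_onb_def by (metis rangeI span_base)+
  have exp: "P j = (\<Sum>i\<in>UNIV. M $ i $ j *\<^sub>R Q i)" for j
    using frob_onb_expand[OF Q inS(1)] by (simp add: M_def)
  have onP: "inner (P i) (P j) = (if i = j then 1 else 0)" for i j
    using P by (simp add: frob_onb_def frob_inner)
  have "inner (P i) (P j) = (\<Sum>k\<in>UNIV. M $ k $ i * M $ k $ j)" for i j
    by (subst exp[of i]) (simp add: inner_sum_left M_def)
  then have "transpose M ** M = mat 1"
    by (simp add: vec_eq_iff matrix_matrix_mult_def transpose_def mat_def onP)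
  then have d: "det M * det M = 1"
    by (metis det_mul det_I det_transpose)
  have "gram Z P = transpose M ** gram Z Q ** M"
  proof -
    have "inner (comm Z (P i)) (comm Z (P j))
        = (\<Sum>l\<in>UNIV. \<Sum>k\<in>UNIV. M $ k $ i * inner (comm Z (Q k)) (comm Z (Q l)) * M $ l $ j)" for i j
      unfolding exp[of i] exp[of j] comm_sum
      by (simp add: inner_sum_left inner_sum_right sum_distrib_left mult_ac)
    then show ?thesis
      by (simp add: vec_eq_iff gram_def frob_inner matrix_matrix_mult_def transpose_def
          sum_distrib_right)
  qed
  then show ?thesis
    using d by (simp add: det_mul det_transpose mult_ac)
qed

lemma R30_eq:
  assumes "frob_onb (Q :: 15 \<Rightarrow> mat7) (E_space T)"
  shows "R30 T Z = det (gram Z Q)"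
  unfolding R30_def
  by (rule det_gram_unique[OF someI[where P = "\<lambda>Q. frob_onb Q (E_space T)", OF assms] assms])

lemma matrix_wrt_expand:
  assumes B: "is_basis (B :: 'n::finite \<Rightarrow> 'v::real_vector) S" and x: "x \<in> S"
  shows "x = (\<Sum>i\<in>UNIV. representation (range B) x (B i) *\<^sub>R B i)"
proof -
  have "x = (\<Sum>b\<in>range B. representation (range B) x b *\<^sub>R b)"
    using B x by (intro real_vector.sum_representation_eq[symmetric]) (auto simp: is_basis_def)
  also have "\<dots> = (\<Sum>i\<in>UNIV. representation (range B) x (B i) *\<^sub>R B i)"
    using B by (simp add: sum.reindex is_basis_def)
  finally show ?thesis .
qed

lemma representation_is_basis:
  assumes "is_basis (B :: 'n::finite \<Rightarrow> 'v::real_vector) S"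
  shows "representation (range B) (\<Sum>i\<in>UNIV. c i *\<^sub>R B i) (B k) = c k"
proof -
  have ind: "independent (range B)" and inj: "inj B" and sp: "\<And>i. B i \<in> span (range B)"
    using assms by (auto simp: is_basis_def intro: span_base)
  have "representation (range B) (\<Sum>i\<in>UNIV. c i *\<^sub>R B i) (B k)
      = (\<Sum>i\<in>UNIV. c i * representation (range B) (B i) (B k))"
    using ind sp
    by (simp add: real_vector.representation_sum real_vector.representation_scale span_scale)
  also have "\<dots> = (\<Sum>i\<in>UNIV. c i * (if i = k then 1 else 0))"
    using ind inj by (intro sum.cong) (auto simp: real_vector.representation_basis inj_eq)
  also have "\<dots> = c k" by (simp add: if_distrib cong: if_cong)
  finally show ?thesis .
qed

lemma det_matrix_wrt_unique:
  assumes B: "is_basis (B :: 'n::finite \<Rightarrow> 'v::real_vector) S" and C: "is_basis (C :: 'n \<Rightarrow> 'v) S"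
    and f: "linear f" "\<And>x. x \<in> S \<Longrightarrow> f x \<in> S"
  shows "det (matrix_wrt B f) = det (matrix_wrt C f)"
proof -
  have inS: "B j \<in> S" "C j \<in> S" for j
    using B C by (auto simp: is_basis_def intro: span_base)
  define M :: "real^'n^'n" where "M = (\<chi> i j. representation (range B) (C j) (B i))"
  define N :: "real^'n^'n" where "N = (\<chi> i j. representation (range C) (B j) (C i))"
  have CM: "C j = (\<Sum>i\<in>UNIV. M $ i $ j *\<^sub>R B i)" for j
    using matrix_wrt_expand[OF B inS(2)] by (simp add: M_def)
  have BN: "B j = (\<Sum>i\<in>UNIV. N $ i $ j *\<^sub>R C i)" for j
    using matrix_wrt_expand[OF C inS(1)] by (simp add: N_def)
  have fB: "f (B j) = (\<Sum>i\<in>UNIV. matrix_wrt B f $ i $ j *\<^sub>R B i)" for j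
    using matrix_wrt_expand[OF B f(2)[OF inS(1)]] by (simp add: matrix_wrt_def)
  have comb: "(\<Sum>i\<in>UNIV. c i *\<^sub>R (\<Sum>k\<in>UNIV. A $ k $ i *\<^sub>R D k))
      = (\<Sum>k\<in>UNIV. (\<Sum>i\<in>UNIV. A $ k $ i * c i) *\<^sub>R D k)"
    for c :: "'n \<Rightarrow> real" and A :: "real^'n^'n" and D :: "'n \<Rightarrow> 'v"
    by (simp add: scaleR_sum_right scaleR_sum_left mult.commute) (rule sum.swap)
  have "representation (range C) (C j) (C k) = (N ** M) $ k $ j" for j k
  proof -
    have "C j = (\<Sum>k\<in>UNIV. (\<Sum>i\<in>UNIV. N $ k $ i * M $ i $ j) *\<^sub>R C k)"
      by (subst CM, subst BN) (rule comb)
    then show ?thesis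
      using representation_is_basis[OF C, of "\<lambda>k. \<Sum>i\<in>UNIV. N $ k $ i * M $ i $ j" k]
      by (simp add: matrix_matrix_mult_def)
  qed
  then have NM: "N ** M = mat 1"
    using C by (auto simp: vec_eq_iff mat_def is_basis_def real_vector.representation_basis inj_eq)
  have "matrix_wrt C f $ k $ j = (N ** matrix_wrt B f ** M) $ k $ j" for j k
  proof -
    have "f (C j) = (\<Sum>i\<in>UNIV. M $ i $ j *\<^sub>R f (B i))"
      by (subst CM) (simp add: linear_sum[OF f(1)] linear_cmul[OF f(1)])
    also have "\<dots> = (\<Sum>k\<in>UNIV. (matrix_wrt B f ** M) $ k $ j *\<^sub>R B k)"
      by (subst fB, subst comb) (simp add: matrix_matrix_mult_def)
    also have "\<dots> = (\<Sum>k\<in>UNIV. (N ** (matrix_wrt B f ** M)) $ k $ j *\<^sub>R C k)"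
      by (subst BN, subst comb) (simp add: matrix_matrix_mult_def)
    finally show ?thesis
      using representation_is_basis[OF C] by (simp add: matrix_wrt_def matrix_mul_assoc)
  qed
  then have "matrix_wrt C f = N ** matrix_wrt B f ** M"
    by (simp add: vec_eq_iff)
  moreover have "det N * det M = 1"
    using NM by (metis det_mul det_I)
  ultimately show ?thesis
    by (simp add: det_mul mult_ac)
qed

lemma det_S0_eq:
  assumes "is_basis (B :: 27 \<Rightarrow> mat7) S0" and "linear f" "\<And>x. x \<in> S0 \<Longrightarrow> f x \<in> S0"
  shows "det_S0 f = det (matrix_wrt B f)"
  unfolding det_S0_def
  by (rule det_matrix_wrt_unique[OF someI[where P = "\<lambda>B. is_basis B S0", OF assms(1)] assms])

end

theory Submission
  imports Defs
begin

text \<open>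
  A Gram determinant is nonnegative, and \<open>\<R>\<^sub>3\<^sub>0(T, Z) = 0\<close> means that some nonzero \<open>Q \<in> \<E>\<^sub>T\<close> commutes
  with \<open>Z\<close>. Such a \<open>Q\<close> commutes with \<open>T\<close>, hence with \<open>Lie {Z, TZT}\<close>, and an eigenspace of \<open>Q\<close> is
  invariant. Conversely, if \<open>P\<close> is the orthogonal projection onto an invariant subspace of dimension
  \<open>d\<close>, then \<open>Q = P + TPT - (2d/7) I\<close> lies in \<open>\<E>\<^sub>T\<close> and commutes with \<open>Z\<close>; it could vanish only if
  \<open>2d = 7\<close>. In an orthonormal basis of \<open>\<S>\<^sub>0\<close> extending one of \<open>\<E>\<^sub>T\<close> the operator
  \<open>\<Pi>\<^sup>- - \<Pi>\<^sup>+ A\<^sub>Z\<^sup>2 \<Pi>\<^sup>+\<close> is block diagonal, with the Gram matrix and an identity as blocks, and its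
  entries are polynomial. The octonions enter only through the facts that \<open>T\<close> is a symmetric
  involution of trace \<open>-1\<close> and that \<open>Z\<close> is skew.
\<close>

section \<open>Projections and determinants\<close>

lemma obtain_orthonormal_basis:
  fixes S :: "'a::euclidean_space set"
  assumes "subspace S"
  obtains B where "finite B" "card B = dim S" "span B = S"
    "\<And>x y. x \<in> B \<Longrightarrow> y \<in> B \<Longrightarrow> inner x y = (if x = y then 1 else 0)"
proof -
  obtain B where B: "pairwise orthogonal B" "\<And>x. x \<in> B \<Longrightarrow> norm x = 1" "independent B"
    "card B = dim S" "span B = S"
    using orthonormal_basis_subspace[OF assms] by metis
  moreover have "inner x y = (if x = y then 1 else 0)" if "x \<in> B" "y \<in> B" for x y
    using B(1,2) that by (auto simp: pairwise_def orthogonal_def norm_eq_1)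
  ultimately show thesis
    using that independent_imp_finite by blast
qed

lemma orthonormal_expansion:
  fixes B :: "'a::real_inner set"
  assumes "finite B" and on: "\<And>x y. x \<in> B \<Longrightarrow> y \<in> B \<Longrightarrow> inner x y = (if x = y then 1 else 0)"
    and "x \<in> span B"
  shows "x = (\<Sum>b\<in>B. inner b x *\<^sub>R b)"
  using \<open>x \<in> span B\<close>
proof (induction rule: span_induct_alt)
  case (step c y z)
  have "(\<Sum>b\<in>B. inner b (c *\<^sub>R y + z) *\<^sub>R b)
      = (\<Sum>b\<in>B. (if b = y then c *\<^sub>R b else 0)) + (\<Sum>b\<in>B. inner b z *\<^sub>R b)"
    unfolding sum.distrib[symmetric]
    by (rule sum.cong) (auto simp: inner_add_right on step(1) scaleR_add_left)
  also have "\<dots> = c *\<^sub>R y + z"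
    using step(1) step(2)[symmetric] assms(1) by (simp add: sum.delta)
  finally show ?case by simp
qed simp

text \<open>In an orthonormal basis \<open>B\<close> of \<open>S\<close> the projection is
  \<open>P x = (\<Sum>b\<in>B. inner b x *\<^sub>R b)\<close>, and Parseval's identity for each
  \<open>b\<close> turns its trace into the sum of the \<open>inner b b = 1\<close>. Three uses
  follow: the dimension of \<open>E_space T\<close>, the trace of a quaternionic reflection, and the
  trace of the projection onto an invariant subspace.\<close>

lemma dim_eq_trace_projection:
  fixes S :: "'a::euclidean_space set"
  assumes S: "subspace S" and P: "\<And>x. P x \<in> S" "\<And>x. x \<in> S \<Longrightarrow> P x = x"
    and adj: "\<And>x y. inner (P x) y = inner x (P y)"
  shows "real (dim S) = (\<Sum>e\<in>Basis. inner e (P e))"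
proof -
  obtain B where B: "finite B" "card B = dim S" "span B = S"
    "\<And>x y. x \<in> B \<Longrightarrow> y \<in> B \<Longrightarrow> inner x y = (if x = y then 1 else 0)"
    using obtain_orthonormal_basis[OF S] by blast
  have "B \<subseteq> S"
    using B(3) span_superset by blast
  have "P x = (\<Sum>b\<in>B. inner b x *\<^sub>R b)" for x
  proof -
    have "inner b (P x) = inner b x" if "b \<in> B" for b
      using that \<open>B \<subseteq> S\<close> P(2) adj by (metis subsetD)
    then show ?thesis
      using orthonormal_expansion[OF B(1) B(4), of "P x"] P(1) B(3) by (simp cong: sum.cong)
  qed
  then have "(\<Sum>e\<in>Basis. inner e (P e)) = (\<Sum>e\<in>Basis. \<Sum>b\<in>B. inner b e * inner b e)"
    by (simp add: inner_sum_right inner_commute)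
  also have "\<dots> = (\<Sum>b\<in>B. \<Sum>e\<in>Basis. inner b e * inner b e)"
    by (rule sum.swap)
  also have "\<dots> = (\<Sum>b\<in>B. inner b b)"
    by (simp only: euclidean_inner[symmetric])
  finally show ?thesis
    using B(2,4) by simp
qed

text \<open>The matrix is the sum of the outer products of the vectors in an orthonormal basis of
  \<open>W\<close> with themselves.\<close>

lemma matrix_projection_exists:
  fixes W :: "(real^'n) set"
  assumes "subspace W"
  obtains P :: "real^'n^'n" where "transpose P = P" "\<And>x. P *v x \<in> W" "\<And>x. x \<in> W \<Longrightarrow> P *v x = x"
proof -
  obtain B where B: "finite B" "span B = W"
    "\<And>x y. x \<in> B \<Longrightarrow> y \<in> B \<Longrightarrow> inner x y = (if x = y then 1 else 0)"
    using obtain_orthonormal_basis[OF assms] by metis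
  define P :: "real^'n^'n" where "P = (\<chi> i j. \<Sum>b\<in>B. b $ i * b $ j)"
  have Px: "P *v x = (\<Sum>b\<in>B. inner b x *\<^sub>R b)" for x
  proof -
    have "(P *v x) $ i = (\<Sum>b\<in>B. inner b x *\<^sub>R b) $ i" for i
    proof -
      have "(P *v x) $ i = (\<Sum>j\<in>UNIV. \<Sum>b\<in>B. b $ i * b $ j * x $ j)"
        by (simp add: P_def matrix_vector_mult_def sum_distrib_right)
      also have "\<dots> = (\<Sum>b\<in>B. \<Sum>j\<in>UNIV. b $ i * b $ j * x $ j)"
        by (rule sum.swap)
      finally show ?thesis
        by (simp add: inner_vec_def sum_distrib_left sum_distrib_right mult_ac)
    qed
    then show ?thesis by (simp add: vec_eq_iff)
  qed
  show thesis
  proof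
    show "transpose P = P"
      by (simp add: P_def transpose_def vec_eq_iff mult.commute)
    show "P *v x \<in> W" for x
      unfolding Px B(2)[symmetric] by (intro span_sum span_scale span_base)
    show "P *v x = x" if "x \<in> W" for x
      unfolding Px using orthonormal_expansion[OF B(1,3), of x] that B(2) by simp
  qed
qed

section \<open>Signs and kernels of determinants\<close>

lemma det_pos_segment:
  fixes A B :: "real^'n^'n"
  assumes nz: "\<And>s. 0 \<le> s \<Longrightarrow> s \<le> 1 \<Longrightarrow> det ((1 - s) *\<^sub>R A + s *\<^sub>R B) \<noteq> 0" and "det A > 0"
  shows "det B > 0"
proof (rule ccontr)
  define f where "f = (\<lambda>s::real. det ((1 - s) *\<^sub>R A + s *\<^sub>R B))"
  assume "\<not> det B > 0"
  then have "f 1 \<le> 0" "0 \<le> f 0"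
    using \<open>det A > 0\<close> by (auto simp: f_def)
  moreover have "continuous_on {0..1} f"
    unfolding f_def det_def by (intro continuous_intros)
  ultimately obtain s where "0 \<le> s" "s \<le> 1" "f s = 0"
    using IVT2'[of f 1 0 0] by (metis zero_le_one)
  then show False
    using nz[of s] by (simp add: f_def)
qed

lemma det_scaleR:
  fixes A :: "real^'n^'n"
  shows "det (c *\<^sub>R A) = c ^ CARD('n) * det A"
  by (simp add: det_def prod.distrib sum_distrib_left mult.left_commute)

lemma det_zero_kernel:
  fixes A :: "real^'n^'n"
  shows "det A = 0 \<longleftrightarrow> (\<exists>x. x \<noteq> 0 \<and> A *v x = 0)"
  using invertible_det_nz[of A] invertible_left_inverse[of A] matrix_left_invertible_ker[of A] by blast

text \<open>For invertible \<open>A\<close> the segment from the identity to \<open>A\<close> avoids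
  singular matrices: pairing a kernel vector \<open>x\<close> at parameter \<open>s\<close> with
  itself leaves only \<open>s = 1\<close>, where \<open>A\<close> itself would be singular.\<close>

lemma det_nonneg_of_psd:
  fixes A :: "real^'n^'n"
  assumes psd: "\<And>x. 0 \<le> inner x (A *v x)"
  shows "0 \<le> det A"
proof (cases "det A = 0")
  case False
  have "det A > 0"
  proof (rule det_pos_segment)
    show "det (mat 1 :: real^'n^'n) > 0" by simp
    fix s :: real assume s: "0 \<le> s" "s \<le> 1"
    show "det ((1 - s) *\<^sub>R mat 1 + s *\<^sub>R A) \<noteq> 0"
    proof
      assume "det ((1 - s) *\<^sub>R mat 1 + s *\<^sub>R A) = 0"
      then obtain x where x: "x \<noteq> 0" "((1 - s) *\<^sub>R mat 1 + s *\<^sub>R A) *v x = 0"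
        using det_zero_kernel by blast
      then have eq: "(1 - s) *\<^sub>R x + s *\<^sub>R (A *v x) = 0"
        by (simp add: matrix_vector_mult_add_rdistrib scaleR_matrix_vector_assoc[symmetric])
      then have "(1 - s) * inner x x + s * inner x (A *v x) = 0"
        by (metis inner_add_right inner_scaleR_right inner_zero_right)
      moreover have "0 \<le> s * inner x (A *v x)" "0 < inner x x"
        using s psd x by auto
      ultimately have "s = 1"
        using s by (smt (verit) mult_pos_pos)
      then have "A *v x = 0"
        using eq by simp
      then show False
        using x False det_zero_kernel by blast
    qed
  qed
  then show ?thesis by simp
qed simp

text \<open>Otherwise \<open>I\<close> is joined to both \<open>A\<close> and \<open>- A\<close> by segments of invertible matrices, although their
  determinants have opposite signs.\<close>

lemma odd_dimension_eigenvalue: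
  fixes A :: "real^'n^'n"
  assumes "odd CARD('n)"
  obtains c x where "x \<noteq> 0" "A *v x = c *\<^sub>R x"
proof -
  have "\<exists>c x. x \<noteq> 0 \<and> A *v x = c *\<^sub>R x"
  proof (rule ccontr)
    assume none: "\<not> (\<exists>c x. x \<noteq> 0 \<and> A *v x = c *\<^sub>R x)"
    have nz: "det ((1 - s) *\<^sub>R mat 1 + s *\<^sub>R M) \<noteq> 0"
      if M: "M = A \<or> M = - A" for s :: real and M
    proof
      assume "det ((1 - s) *\<^sub>R mat 1 + s *\<^sub>R M) = 0"
      then obtain x where x: "x \<noteq> 0" "((1 - s) *\<^sub>R mat 1 + s *\<^sub>R M) *v x = 0"
        using det_zero_kernel by blast
      then have eq: "(1 - s) *\<^sub>R x + s *\<^sub>R (M *v x) = 0"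
        by (simp add: matrix_vector_mult_add_rdistrib scaleR_matrix_vector_assoc[symmetric])
      have "s \<noteq> 0" using eq x(1) by auto
      have "s *\<^sub>R (M *v x) = (s - 1) *\<^sub>R x"
        using eq by (simp add: algebra_simps add_eq_0_iff)
      then have "inverse s *\<^sub>R (s *\<^sub>R (M *v x)) = inverse s *\<^sub>R ((s - 1) *\<^sub>R x)"
        by (rule arg_cong)
      \<comment> \<open>A kernel vector on the segment is an eigenvector of \<open>M\<close>; for
        \<open>M = - A\<close> the eigenvalue of \<open>A\<close> is the negative of this
        one.\<close>
      then have Mx: "M *v x = ((s - 1) / s) *\<^sub>R x"
        using \<open>s \<noteq> 0\<close> by (simp add: divide_inverse mult.commute)
      have neg: "(- A) *v x = - (A *v x)"
        by (simp add: matrix_vector_mult_def vec_eq_iff sum_negf)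
      from M show False
      proof
        assume "M = A"
        then show False using none x(1) Mx by blast
      next
        assume "M = - A"
        then have "A *v x = (- ((s - 1) / s)) *\<^sub>R x"
          using Mx neg by (simp only: scaleR_minus_left) (metis minus_minus)
        then show False using none x(1) by blast
      qed
    qed
    have "det M > 0" if "M = A \<or> M = - A" for M
      by (rule det_pos_segment[where A = "mat 1"]) (use nz[OF that] in simp_all)
    then have "det A > 0" "det (- A) > 0" by blast+
    \<comment> \<open>The odd dimension enters here, as the sign of
      \<open>(-1) ^ CARD('n)\<close>.\<close>
    moreover have "det (- A) = - det A"
      using assms det_scaleR[of "-1" A] by simp
    ultimately show False by simp
  qed
  then show thesis using that by blast
qed

text \<open>The rows outside \<open>range f\<close> are rows of the identity, so a term of the
  Leibniz formula survives only if its permutation fixes all indices outside \<open>range f\<close>.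
  Such permutations are the transports along \<open>f\<close> of permutations of \<open>'m\<close>,
  with the same sign.\<close>

lemma det_identity_rows:
  fixes M :: "real^'n^'n" and f :: "'m::finite \<Rightarrow> 'n"
  assumes f: "inj f" and id: "\<And>i j. i \<notin> range f \<Longrightarrow> M $ i $ j = (if i = j then 1 else 0)"
  shows "det M = det (\<chi> i j. M $ f i $ f j)"
proof -
  let ?g = "\<lambda>p. of_int (sign p) * (\<Prod>i\<in>UNIV. M $ i $ p i)"
  let ?R = "range f"
  have bij: "bij_betw f UNIV ?R"
    using f by (simp add: bij_betw_def)
  have "det M = (\<Sum>p | p permutes UNIV. ?g p)"
    by (simp add: det_def)
  also have "\<dots> = (\<Sum>p | p permutes ?R. ?g p)"
  proof (rule sum.mono_neutral_right)
    show "{p. p permutes ?R} \<subseteq> {p. p permutes UNIV}"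
      using permutes_subset by auto
    show "\<forall>p\<in>{p. p permutes UNIV} - {p. p permutes ?R}. ?g p = 0"
    proof
      fix p assume "p \<in> {p. p permutes UNIV} - {p. p permutes ?R}"
      then obtain i where "i \<notin> ?R" "p i \<noteq> i"
        by (auto simp: permutes_def)
      then have "M $ i $ p i = 0" using id by auto
      then show "?g p = 0" by (auto intro!: prod_zero)
    qed
  qed simp
  also have "\<dots> = (\<Sum>q | q permutes (UNIV::'m set). ?g (map_permutation UNIV f q))"
  proof (rule sum.reindex_bij_witness[of _ "map_permutation UNIV f" "map_permutation ?R (inv f)"])
    fix p assume p: "p \<in> {p. p permutes ?R}"
    have "bij_betw (inv f) ?R UNIV"
      using f by (simp add: bij_betw_inv_into bij)
    then show "map_permutation UNIV f (map_permutation ?R (inv f) p) = p"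
      and "map_permutation ?R (inv f) p \<in> {q. q permutes UNIV}"
      using p f by (auto intro!: map_permutation_compose_inv map_permutation_permutes)
    then show "?g (map_permutation UNIV f (map_permutation ?R (inv f) p)) = ?g p" by simp
  next
    fix q assume "q \<in> {q. q permutes (UNIV::'m set)}"
    then show "map_permutation ?R (inv f) (map_permutation UNIV f q) = q"
      and "map_permutation UNIV f q \<in> {p. p permutes ?R}"
      using bij f by (auto intro!: map_permutation_compose_inv map_permutation_permutes)
  qed
  also have "\<dots> = (\<Sum>q | q permutes (UNIV::'m set).
      of_int (sign q) * (\<Prod>i\<in>UNIV. M $ f i $ f (q i)))"
  proof (rule sum.cong)
    fix q assume "q \<in> {q. q permutes (UNIV::'m set)}"
    then have q: "q permutes UNIV" by simp
    let ?p = "map_permutation UNIV f q"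
    have "?p permutes ?R"
      using q bij by (rule map_permutation_permutes[rotated])
    then have "M $ i $ ?p i = 1" if "i \<notin> ?R" for i
      using that id by (simp add: permutes_not_in)
    then have "(\<Prod>i\<in>UNIV. M $ i $ ?p i) = (\<Prod>i\<in>?R. M $ i $ ?p i)"
      by (intro prod.mono_neutral_right) auto
    also have "\<dots> = (\<Prod>i\<in>UNIV. M $ f i $ f (q i))"
      using f by (simp add: prod.reindex map_permutation_apply)
    finally show "?g ?p = of_int (sign q) * (\<Prod>i\<in>UNIV. M $ f i $ f (q i))"
      using q f by (simp add: sign_map_permutation)
  qed simp
  also have "\<dots> = det (\<chi> i j. M $ f i $ f j)"
    by (simp add: det_def)
  finally show ?thesis .
qed

section \<open>Symmetric matrices commuting with an involution\<close>

lemma inner_mat7: "inner U W = trace (transpose U ** W)" for U W :: mat7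
  by (simp add: frob_inner[symmetric] frob_def)

lemma trace_transpose: "trace (transpose A) = trace A" for A :: "'a::semiring_1^'n^'n"
  by (simp add: trace_def transpose_def)

lemma inner_transpose: "inner (transpose U) W = inner U (transpose W)" for U W :: mat7
  using trace_transpose[of "W ** U"] trace_mul_sym[of W U]
  by (simp add: inner_mat7 matrix_transpose_mul)

lemma inner_matrix_mult_left: "inner (A ** U) W = inner U (transpose A ** W)" for U W :: mat7
  by (simp add: inner_mat7 matrix_transpose_mul matrix_mul_assoc)

lemma inner_matrix_mult_right: "inner (U ** A) W = inner U (W ** transpose A)" for U W :: mat7
proof -
  have "inner (U ** A) W = trace (transpose A ** (transpose U ** W))"
    by (simp add: inner_mat7 matrix_transpose_mul matrix_mul_assoc)
  also have "\<dots> = trace ((transpose U ** W) ** transpose A)"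
    by (rule trace_mul_sym)
  finally show ?thesis
    by (simp add: inner_mat7 matrix_mul_assoc)
qed

lemma inner_mat_1: "inner (mat 1) U = trace U" for U :: mat7
  by (simp add: inner_mat7)

lemma inner_mat_1': "inner U (mat 1) = trace U" for U :: mat7
  using inner_mat_1[of U] by (simp add: inner_commute)

text \<open>In particular \<open>Q \<mapsto> T ** Q ** T\<close> is self-adjoint when
  \<open>T\<close> is symmetric, and conjugation by an orthogonal matrix is an isometry.\<close>

lemma inner_sandwich: "inner (A ** U ** B) W = inner U (transpose A ** W ** transpose B)" for U W :: mat7
  by (simp add: inner_matrix_mult_right[of "A ** U"] inner_matrix_mult_left[of A] matrix_mul_assoc)

lemma matrix_minus_left: "(- A) ** B = - (A ** B)" for A B :: "'a::ring_1^'n^'n"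
  by (simp add: matrix_matrix_mult_def vec_eq_iff sum_negf)

lemma matrix_minus_right: "A ** (- B) = - (A ** B)" for A B :: "'a::ring_1^'n^'n"
  by (simp add: matrix_matrix_mult_def vec_eq_iff sum_negf)

lemma matrix_add_left: "(A + C) ** B = A ** B + C ** B" for A B :: "'a::semiring_1^'n^'n"
  by (simp add: matrix_matrix_mult_def vec_eq_iff sum.distrib algebra_simps)

lemma matrix_diff_left: "(A - C) ** B = A ** B - C ** B" for A B :: "'a::ring_1^'n^'n"
  by (simp add: matrix_matrix_mult_def vec_eq_iff sum_subtractf algebra_simps)

lemma matrix_diff_right: "A ** (B - C) = A ** B - A ** C" for A B :: "'a::ring_1^'n^'n"
  by (simp add: matrix_matrix_mult_def vec_eq_iff sum_subtractf algebra_simps)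

lemma matrix_scaleR_left: "(c *\<^sub>R A) ** B = c *\<^sub>R (A ** B)" for A B :: "real^'n^'n"
  by (simp add: scalar_matrix_assoc)

lemma matrix_scaleR_right: "A ** (c *\<^sub>R B) = c *\<^sub>R (A ** B)" for A B :: "real^'n^'n"
  by (simp add: matrix_scalar_ac scalar_matrix_assoc)

lemma trace_scaleR: "trace (c *\<^sub>R A) = c * trace A" for A :: "real^'n^'n"
  by (simp add: trace_def sum_distrib_left)

lemma transpose_add: "transpose (A + B) = transpose A + transpose B" for A B :: "'a::semiring_1^'n^'m"
  by (simp add: transpose_def vec_eq_iff)

lemma transpose_diff: "transpose (A - B) = transpose A - transpose B" for A B :: "'a::ring_1^'n^'m"
  by (simp add: transpose_def vec_eq_iff)

lemmas matrix_algebra = matrix_add_ldistrib matrix_add_left matrix_diff_left matrix_diff_right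
  matrix_minus_left matrix_minus_right matrix_scaleR_left matrix_scaleR_right
  transpose_add transpose_diff transpose_scalar matrix_transpose_mul

lemma involution_cancel:
  fixes T :: "real^'n^'n"
  assumes "T ** T = mat 1"
  shows "T ** (T ** X) = X" "X ** T ** T = X"
  using assms by (simp add: matrix_mul_assoc, simp add: assms matrix_mul_assoc[symmetric])

lemma trace_conj: "trace (T ** Q ** T) = trace Q" if "T ** T = mat 1" for T :: "real^'n^'n"
proof -
  have "trace (T ** Q ** T) = trace (T ** (T ** Q))"
    by (rule trace_mul_sym)
  then show ?thesis
    by (simp add: involution_cancel(1)[OF that])
qed

section \<open>The space \<open>E_space T\<close> and its dimension\<close>

lemma subspace_E_space: "subspace (E_space T)"
  by (auto simp: subspace_def E_space_def S0_def matrix_algebra trace_add trace_scaleR)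
    (auto simp: trace_def transpose_def zero_vec_def)

lemma sum_Basis_matrix:
  "sum f (Basis :: (real^'n^'m) set) = (\<Sum>i\<in>UNIV. \<Sum>j\<in>UNIV. f (axis i (axis j 1)))"
proof -
  have B: "(Basis :: (real^'n^'m) set) = (\<lambda>(i, j). axis i (axis j 1)) ` (UNIV \<times> UNIV)"
    by (auto simp: Basis_vec_def image_iff)
  have "inj_on (\<lambda>(i, j). axis i (axis j 1) :: real^'n^'m) (UNIV \<times> UNIV)"
    by (auto simp: inj_on_def axis_eq_axis)
  then show ?thesis
    by (simp add: B sum.reindex sum.cartesian_product case_prod_unfold)
qed

lemma matrix_unit_sandwich:
  "(A ** axis k (axis l 1) ** B) $ i $ j = A $ i $ k * B $ l $ j" for A B :: "real^'n^'n"
proof -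
  have "(A ** axis k (axis l 1)) $ i $ m = (if m = l then A $ i $ k else 0)" for m
    by (simp add: matrix_matrix_mult_def axis_def if_distrib[where f = "\<lambda>x. x $ m"]
        if_distrib[where f = "\<lambda>x. _ * x"] cong: if_cong)
  then show ?thesis
    by (subst matrix_matrix_mult_def) (simp add: if_distrib[where f = "\<lambda>x. x * _"] cong: if_cong)
qed

text \<open>The orthogonal projection onto \<open>E_space T\<close> averages over the group generated by transposition and
  \<open>Q \<mapsto> TQT\<close> and then removes the trace part.\<close>

lemma dim_E_space:
  assumes T: "transpose T = T" "T ** T = mat 1"
  shows "real (dim (E_space T)) = (59 + (trace T)\<^sup>2) / 4"
proof -
  define P :: "mat7 \<Rightarrow> mat7" where
    "P Q = (1/4) *\<^sub>R (Q + transpose Q + T ** Q ** T + T ** transpose Q ** T) - (trace Q / 7) *\<^sub>R mat 1" for Q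
  have "real (dim (E_space T)) = (\<Sum>e\<in>Basis. inner e (P e))"
  proof (rule dim_eq_trace_projection[OF subspace_E_space])
    fix Q R
    show "P Q \<in> E_space T"
      by (simp add: P_def E_space_def S0_def matrix_algebra T trace_add trace_sub trace_scaleR trace_conj[OF T(2)] trace_I
          trace_transpose matrix_mul_assoc involution_cancel[OF T(2)])
    show "P Q = Q" if "Q \<in> E_space T"
    proof -
      have "transpose Q = Q" "trace Q = 0" "T ** Q ** T = Q"
        using that by (auto simp: E_space_def S0_def)
      then show ?thesis
        by (simp only: P_def) (simp add: vec_eq_iff)
    qed
    show "inner (P Q) R = inner Q (P R)"
      by (simp add: P_def inner_add_left inner_add_right inner_diff_left inner_diff_right
          inner_sandwich inner_transpose T matrix_transpose_mul matrix_mul_assoc inner_mat_1 inner_mat_1')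
  qed
  \<comment> \<open>The trace is taken over matrix units. The four numerators are the diagonal
    coefficients of the identity, of transposition, of \<open>Q \<mapsto> TQT\<close> and of the
    composite of the last two; \<open>1 / 7\<close> comes from removing the trace part.\<close>
  also have "\<dots> = (\<Sum>i\<in>UNIV. \<Sum>j\<in>UNIV. ((1 + (if i = j then 1 else 0) + T $ i $ i * T $ j $ j + T $ i $ j * T $ i $ j) / 4
      - (if i = j then 1 / 7 else 0)))"
  proof -
    have "inner (axis i (axis j 1)) (P (axis i (axis j 1)))
        = (1 + (if i = j then 1 else 0) + T $ i $ i * T $ j $ j + T $ i $ j * T $ i $ j) / 4
          - (if i = j then 1 / 7 else 0)" for i j
    proof -
      let ?e = "axis i (axis j 1) :: mat7"
      have "inner ?e (P ?e) = P ?e $ i $ j"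
        by (simp add: inner_axis')
      moreover have "transpose ?e = axis j (axis i 1)"
        by (simp add: transpose_def axis_def vec_eq_iff)
      moreover have "trace ?e = (if i = j then 1 else 0)"
        by (simp add: trace_def axis_def if_distrib[where f = "\<lambda>x. x $ _"] cong: if_cong)
      moreover have "?e $ i $ j = 1" "(axis j (axis i 1) :: mat7) $ i $ j = (if i = j then 1 else 0)"
        by (simp_all add: axis_def)
      moreover have "(mat 1 :: mat7) $ i $ j = (if i = j then 1 else 0)"
        by (simp add: mat_def)
      ultimately show ?thesis
        by (simp add: P_def matrix_unit_sandwich)
    qed
    then show ?thesis
      by (simp add: sum_Basis_matrix)
  qed
  also have "\<dots> = (49 + 7 + (\<Sum>i\<in>UNIV. \<Sum>j\<in>UNIV. T $ i $ i * T $ j $ j)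
      + (\<Sum>i\<in>UNIV. \<Sum>j\<in>UNIV. T $ i $ j * T $ i $ j)) / 4 - 1"
    by (simp add: sum.distrib sum_subtractf sum_divide_distrib[symmetric])
  also have "(\<Sum>i\<in>UNIV. \<Sum>j\<in>UNIV. T $ i $ i * T $ j $ j) = (trace T)\<^sup>2"
    by (simp add: trace_def power2_eq_square sum_product)
  also have "(\<Sum>i\<in>UNIV. \<Sum>j\<in>UNIV. T $ i $ j * T $ i $ j) = inner T T"
    by (simp add: inner_vec_def)
  \<comment> \<open>Since \<open>T\<close> is a symmetric involution,
    \<open>transpose T ** T\<close> is the identity. The total is
    \<open>(49 + 7 + (trace T)\<^sup>2 + 7) / 4 - 1\<close>.\<close>
  also have "inner T T = 7"
    by (simp add: inner_mat7 T trace_I)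
  finally show ?thesis
    by simp
qed

text \<open>Viewing \<open>S0\<close> as the case \<open>T = I\<close> makes the results on
  \<open>E_space\<close> available for it; the dimension is then
  \<open>(59 + 49) / 4 = 27\<close>.\<close>

lemma S0_eq_E_space: "S0 = E_space (mat 1)"
  by (simp add: E_space_def)

lemma dim_S0: "dim S0 = 27"
  using dim_E_space[of "mat 1"] by (simp add: S0_eq_E_space trace_I)

section \<open>Frobenius-orthonormal families and linearity of the operators\<close>

text \<open>The range is kept in the conclusion so that an indexed basis of \<open>S0\<close> can be
  seen to extend one of \<open>E_space T\<close>.\<close>

lemma frob_onb_of_set:
  fixes S :: "mat7 set"
  assumes "finite B" "card B = CARD('n::finite)" "span B = S"
    and on: "\<And>x y. x \<in> B \<Longrightarrow> y \<in> B \<Longrightarrow> inner x y = (if x = y then 1 else 0)"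
  obtains Q :: "'n::finite \<Rightarrow> mat7" where "frob_onb Q S" "range Q = B" "inj Q"
proof -
  obtain Q :: "'n \<Rightarrow> mat7" where "bij_betw Q UNIV B"
    using assms(1,2) by (metis finite_class.finite_UNIV finite_same_card_bij)
  then have Q: "inj Q" "range Q = B"
    by (auto simp: bij_betw_def)
  then have "frob_onb Q S"
    using on assms(3) by (auto simp: frob_onb_def frob_inner inj_eq)
  with Q that show thesis by blast
qed

lemma frob_onb_exists:
  fixes S :: "mat7 set"
  assumes "subspace S" "dim S = CARD('n::finite)"
  obtains Q :: "'n::finite \<Rightarrow> mat7" where "frob_onb Q S"
  using obtain_orthonormal_basis[OF assms(1)] frob_onb_of_set[where 'n = 'n] assms(2) by metis

lemma frob_onb_imp_basis:
  assumes "frob_onb Q S"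
  shows "is_basis Q S"
proof -
  have on: "inner (Q i) (Q j) = (if i = j then 1 else 0)" for i j
    using assms by (simp add: frob_onb_def frob_inner)
  have "inj Q"
    by (rule injI) (metis on zero_neq_one)
  moreover have "independent (range Q)"
  proof (rule pairwise_orthogonal_independent)
    show "pairwise orthogonal (range Q)"
      using on by (auto simp: pairwise_def orthogonal_def)
    show "0 \<notin> range Q"
      using on by (metis imageE inner_zero_left zero_neq_one)
  qed
  ultimately show ?thesis
    using assms by (simp add: is_basis_def frob_onb_def)
qed

lemma linear_comm: "linear (comm Z)"
  by (rule linearI) (simp_all add: comm_def matrix_algebra scaleR_diff_right)

lemma linear_Pi_plus: "linear (Pi_plus T)"
  by (rule linearI) (simp_all add: Pi_plus_def matrix_algebra scaleR_add_right mult.commute)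

lemma linear_Pi_minus: "linear (Pi_minus T)"
  by (rule linearI) (simp_all add: Pi_minus_def matrix_algebra scaleR_add_right scaleR_diff_right mult.commute)

lemma linear_R30_operator: "linear (R30_operator T Z)"
proof -
  have "R30_operator T Z = (\<lambda>Q. Pi_minus T Q - (Pi_plus T \<circ> (comm Z \<circ> (comm Z \<circ> Pi_plus T))) Q)"
    by (simp add: R30_operator_def fun_eq_iff)
  then show ?thesis
    by (simp only: linear_compose_sub linear_compose linear_comm linear_Pi_plus linear_Pi_minus)
qed

section \<open>The two determinants\<close>

text \<open>Conjugation by an arbitrary orthogonal matrix preserves these conditions, whereas it
  need not preserve \<C>; the invariance statement therefore works with this larger class.\<close>

definition reflection_matrix :: "mat7 \<Rightarrow> bool" where
  "reflection_matrix T \<longleftrightarrow> transpose T = T \<and> T ** T = mat 1 \<and> trace T = - 1"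

lemma reflection_matrixD:
  assumes "reflection_matrix T"
  shows "transpose T = T" "T ** T = mat 1" "trace T = - 1"
  using assms by (auto simp: reflection_matrix_def)

lemma dim_E_space_reflection: "dim (E_space T) = 15" if "reflection_matrix T"
  using dim_E_space[OF reflection_matrixD(1,2)[OF that]] reflection_matrixD(3)[OF that] by simp

lemma obtain_frob_onb_E_space:
  assumes "reflection_matrix T"
  obtains Q :: "15 \<Rightarrow> mat7" where "frob_onb Q (E_space T)"
  using frob_onb_exists[OF subspace_E_space[of T], where 'n = 15] dim_E_space_reflection[OF assms] by auto

text \<open>Commutation with a skew matrix is a skew operator, so minus its square has the entries
  of the Gram matrix as its matrix coefficients.\<close>

lemma comm_skew:
  assumes "transpose Z = - Z"
  shows "inner (comm Z U) W = - inner U (comm Z W)"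
  by (simp add: comm_def inner_diff_left inner_diff_right inner_matrix_mult_left[of Z] inner_matrix_mult_right[of _ Z] assms
      matrix_minus_left matrix_minus_right)

lemma Pi_plus_in_E_space:
  assumes "reflection_matrix T" "Q \<in> S0"
  shows "Pi_plus T Q \<in> E_space T"
  using assms reflection_matrixD[OF assms(1)]
  by (simp add: Pi_plus_def E_space_def S0_def matrix_algebra trace_add trace_scaleR trace_conj
      matrix_mul_assoc involution_cancel add.commute)

lemma comm_comm_S0:
  assumes "transpose Z = - Z" "Q \<in> S0"
  shows "comm Z (comm Z Q) \<in> S0"
proof -
  have "trace (comm Z X) = 0" for X
    using trace_mul_sym[of Z X] by (simp add: comm_def trace_sub)
  moreover have "transpose (comm Z X) = comm Z X" if "transpose X = X" for X
    using assms(1) that by (simp add: comm_def matrix_algebra)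
  ultimately show ?thesis
    using assms(2) by (simp add: S0_def)
qed

lemma Pi_plus_adjoint:
  assumes "transpose T = T"
  shows "inner (Pi_plus T U) W = inner U (Pi_plus T W)"
  by (simp add: Pi_plus_def inner_add_left inner_add_right inner_sandwich assms)

lemma R30_operator_E_space:
  assumes "Q \<in> E_space T"
  shows "R30_operator T Z Q = - Pi_plus T (comm Z (comm Z Q))"
proof -
  have "T ** Q ** T = Q" using assms by (simp add: E_space_def)
  then have "Pi_plus T Q = Q" "Pi_minus T Q = 0"
    by (simp_all add: Pi_plus_def Pi_minus_def scaleR_2[symmetric])
  then show ?thesis by (simp add: R30_operator_def)
qed

text \<open>On \<open>S0\<close> the map \<open>Pi_plus T\<close> is the orthogonal projection onto
  \<open>E_space T\<close>, so it kills \<open>Q\<close>. Hence \<open>TQT = - Q\<close>, and only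
  the term \<open>Pi_minus T Q = Q\<close> remains.\<close>

lemma R30_operator_orthogonal:
  assumes T: "reflection_matrix T" and Q: "Q \<in> S0" and orth: "\<And>Y. Y \<in> E_space T \<Longrightarrow> inner Q Y = 0"
  shows "R30_operator T Z Q = Q"
proof -
  have "Pi_plus T Q \<in> E_space T"
    using Pi_plus_in_E_space[OF T Q] .
  moreover from this have "Pi_plus T (Pi_plus T Q) = Pi_plus T Q"
    by (simp add: E_space_def Pi_plus_def[of T "Pi_plus T Q"] scaleR_2[symmetric])
  ultimately have "inner (Pi_plus T Q) (Pi_plus T Q) = 0"
    using Pi_plus_adjoint[OF reflection_matrixD(1)[OF T], of Q "Pi_plus T Q"] orth by simp
  then have zero: "Pi_plus T Q = 0" by simp
  then have "T ** Q ** T = - Q"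
    by (simp add: Pi_plus_def add_eq_0_iff)
  then have "Pi_minus T Q = Q"
    by (simp add: Pi_minus_def scaleR_2[symmetric])
  with zero show ?thesis
    by (simp add: R30_operator_def linear_0[OF linear_comm] linear_0[OF linear_Pi_plus])
qed

lemma R30_operator_S0:
  assumes "reflection_matrix T" "transpose Z = - Z" "Q \<in> S0"
  shows "R30_operator T Z Q \<in> S0"
proof -
  have sub: "subspace S0"
    by (simp add: S0_eq_E_space subspace_E_space)
  have plus: "Pi_plus T X \<in> S0" if "X \<in> S0" for X
    using Pi_plus_in_E_space[OF assms(1) that] by (simp add: E_space_def)
  have "Pi_minus T Q = Q - Pi_plus T Q"
    by (simp add: Pi_minus_def Pi_plus_def vec_eq_iff field_simps)
  then show ?thesis
    unfolding R30_operator_def using assms plus comm_comm_S0 subspace_diff[OF sub] by simp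
qed

text \<open>Coordinates in an orthonormal basis are inner products, which replaces the abstract
  \<open>representation\<close> by explicit entries.\<close>

lemma det_S0_orthonormal:
  assumes B: "frob_onb (B :: 27 \<Rightarrow> mat7) S0" and f: "linear f" "\<And>Q. Q \<in> S0 \<Longrightarrow> f Q \<in> S0"
  shows "det_S0 f = det (\<chi> i j. inner (B i) (f (B j)))"
proof -
  have BS: "B j \<in> S0" for j
    using B unfolding frob_onb_def by (metis rangeI span_base)
  have "representation (range B) (f (B j)) (B i) = inner (B i) (f (B j))" for i j
    using representation_is_basis[OF frob_onb_imp_basis[OF B], of "\<lambda>i. inner (B i) (f (B j))" i]
      frob_onb_expand[OF B f(2)[OF BS]] by simp
  then show ?thesis
    by (simp add: det_S0_eq[OF frob_onb_imp_basis[OF B] f] matrix_wrt_def)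
qed

lemma R30_eq_det_S0:
  assumes T: "reflection_matrix T" and Z: "transpose Z = - Z"
  shows "R30 T Z = det_S0 (R30_operator T Z)"
proof -
  let ?E = "E_space T"
  \<comment> \<open>The orthogonal complement of \<open>E_space T\<close> is taken inside
    \<open>S0\<close>, so that \<open>B1\<close> and \<open>B2\<close> together form an orthonormal
    basis of \<open>S0\<close>.\<close>
  let ?C = "{y \<in> S0. \<forall>x\<in>?E. inner x y = 0}"
  have subS: "subspace S0"
    by (simp add: S0_eq_E_space subspace_E_space)
  have ES: "?E \<subseteq> S0"
    by (auto simp: E_space_def)
  obtain B1 where B1: "finite B1" "card B1 = dim ?E" "span B1 = ?E"
    "\<And>x y. x \<in> B1 \<Longrightarrow> y \<in> B1 \<Longrightarrow> inner x y = (if x = y then 1 else 0)"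
    using obtain_orthonormal_basis[OF subspace_E_space[of T]] by metis
  have subC: "subspace ?C"
    using subS by (auto simp: subspace_def inner_add_right)
  obtain B2 where B2: "finite B2" "card B2 = dim ?C" "span B2 = ?C"
    "\<And>x y. x \<in> B2 \<Longrightarrow> y \<in> B2 \<Longrightarrow> inner x y = (if x = y then 1 else 0)"
    using obtain_orthonormal_basis[OF subC] by blast
  have sub: "B1 \<subseteq> ?E" "B2 \<subseteq> ?C"
    using B1(3) B2(3) span_superset by blast+
  have cross: "inner x y = 0" "inner y x = 0" if "x \<in> B1" "y \<in> B2" for x y
  proof -
    show "inner x y = 0" using that sub by blast
    then show "inner y x = 0" by (simp only: inner_commute)
  qed
  have disj: "B1 \<inter> B2 = {}"
    using cross(1) B1(4) by (metis disjoint_iff zero_neq_one)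
  have on: "inner x y = (if x = y then 1 else 0)" if "x \<in> B1 \<union> B2" "y \<in> B1 \<union> B2" for x y
  proof (cases "x \<in> B1 \<longleftrightarrow> y \<in> B1")
    case True
    then show ?thesis using that B1(4)[of x y] B2(4)[of x y] by blast
  next
    case False
    then have "inner x y = 0" using that cross[of x y] cross[of y x] by blast
    then show ?thesis using False by auto
  qed
  have span: "span (B1 \<union> B2) = S0"
  proof
    have "B1 \<union> B2 \<subseteq> S0" using sub ES by auto
    then show "span (B1 \<union> B2) \<subseteq> S0"
      using subS span_minimal by blast
    show "S0 \<subseteq> span (B1 \<union> B2)"
    proof
      fix Q assume Q: "Q \<in> S0"
      obtain y z where yz: "y \<in> span ?E" "\<And>w. w \<in> span ?E \<Longrightarrow> orthogonal z w" "Q = y + z"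
        using orthogonal_subspace_decomp_exists[of ?E Q] by metis
      then have y: "y \<in> ?E"
        by (simp add: span_eq_iff[THEN iffD2, OF subspace_E_space])
      have "z = Q - y"
        using yz(3) by simp
      then have "z \<in> ?C"
        using Q y ES subspace_diff[OF subS] yz(2) by (auto simp: orthogonal_def inner_commute span_base)
      then have "y + z \<in> span (B1 \<union> B2)"
        using y B1(3) B2(3) by (intro span_add) (auto intro: span_mono[THEN subsetD, rotated])
      then show "Q \<in> span (B1 \<union> B2)" by (simp add: yz(3))
    qed
  qed
  have "independent (B1 \<union> B2)"
  proof (rule pairwise_orthogonal_independent)
    show "pairwise orthogonal (B1 \<union> B2)"
      unfolding pairwise_def orthogonal_def using on by simp
    show "0 \<notin> B1 \<union> B2"
      using on[of 0 0] by auto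
  qed
  then have "card (B1 \<union> B2) = CARD(27)"
    using dim_S0 dim_span_eq_card_independent span by fastforce
  then obtain B :: "27 \<Rightarrow> mat7" where B: "frob_onb B S0" "range B = B1 \<union> B2" "inj B"
    using frob_onb_of_set[OF _ _ span on, where 'n = 27] B1(1) B2(1) by blast
  obtain Q :: "15 \<Rightarrow> mat7" where Q: "frob_onb Q ?E" "range Q = B1" "inj Q"
    using frob_onb_of_set[OF B1(1) _ B1(3,4), where 'n = 15] B1(2) dim_E_space_reflection[OF T] by auto
  \<comment> \<open>The embedding of the 15 indices into the 27 that sends the index of a matrix of
    \<open>B1\<close> under \<open>Q\<close> to its index under \<open>B\<close>.\<close>
  define f where "f = inv B \<circ> Q"
  have Bf: "B (f i) = Q i" for i
    using Q(2) B(2) by (auto simp: f_def intro!: f_inv_into_f)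
  have inj: "inj f"
    by (rule injI) (metis Bf Q(3) injD)
  have Bi: "B i \<in> B2" if "i \<notin> range f" for i
  proof (rule ccontr)
    assume "B i \<notin> B2"
    then obtain k where "B i = Q k"
      using B(2) Q(2) by (metis UnE imageE rangeI)
    then have "i = f k"
      using Bf B(3) by (metis injD)
    with that show False by blast
  qed
  let ?M = "\<chi> i j. inner (B i) (R30_operator T Z (B j))"
  \<comment> \<open>Here \<open>B i\<close> lies in the complement. The operator maps
    \<open>E_space T\<close> into itself, hence orthogonally to \<open>B i\<close>, and fixes the
    basis matrices of the complement.\<close>
  have rows: "?M $ i $ j = (if i = j then 1 else 0)" if "i \<notin> range f" for i j
  proof -
    have "inner (B i) (R30_operator T Z (B j)) = (if i = j then 1 else 0)"
    proof (cases "B j \<in> B1")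
      case True
      then have "B j \<in> ?E" using sub by auto
      then have "R30_operator T Z (B j) = - Pi_plus T (comm Z (comm Z (B j)))"
        by (rule R30_operator_E_space)
      moreover have "Pi_plus T (comm Z (comm Z (B j))) \<in> ?E"
        using Pi_plus_in_E_space[OF T comm_comm_S0[OF Z]] \<open>B j \<in> ?E\<close> ES by blast
      moreover have "i \<noteq> j"
        using Bi[OF that] True disj by auto
      ultimately show ?thesis
        using Bi[OF that] sub(2) by (auto simp: inner_commute)
    next
      case False
      then have "B j \<in> ?C" using B(2) sub(2) by auto
      then have "R30_operator T Z (B j) = B j"
        using R30_operator_orthogonal[OF T] by (auto simp: inner_commute)
      then show ?thesis
        using B(1) by (simp add: frob_onb_def frob_inner)
    qed
    then show ?thesis by simp
  qed
  \<comment> \<open>\<open>Pi_plus T\<close> is self-adjoint and fixes \<open>Q i\<close>, so it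
    drops out; skewness of \<open>comm Z\<close> moves one bracket across and absorbs the minus
    sign.\<close>
  have entry: "inner (Q i) (R30_operator T Z (Q j)) = inner (comm Z (Q i)) (comm Z (Q j))" for i j
  proof -
    have QE: "Q k \<in> ?E" for k
      using Q(2) sub by auto
    have "Pi_plus T (Q i) = Q i"
      using QE[of i] by (simp add: Pi_plus_def E_space_def scaleR_2[symmetric])
    then show ?thesis
      using Pi_plus_adjoint[OF reflection_matrixD(1)[OF T], of "Q i" "comm Z (comm Z (Q j))"]
        comm_skew[OF Z, of "Q i" "comm Z (Q j)"]
      by (simp add: R30_operator_E_space[OF QE])
  qed
  have "det_S0 (R30_operator T Z) = det ?M"
    using det_S0_orthonormal[OF B(1) linear_R30_operator R30_operator_S0[OF T Z]] .
  also have "\<dots> = det (\<chi> i j. ?M $ f i $ f j)"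
    using det_identity_rows[OF inj, of ?M] rows by blast
  also have "(\<chi> i j. ?M $ f i $ f j) = gram Z Q"
    by (simp add: Bf entry gram_def frob_inner vec_eq_iff)
  finally show ?thesis
    using R30_eq[OF Q(1)] by simp
qed

section \<open>Nonnegativity and the zero criterion\<close>

text \<open>With \<open>v\<close> the coordinate isomorphism from \<open>real^15\<close> onto
  \<open>E_space T\<close>, the quadratic form of the Gram matrix at \<open>x\<close> is the squared
  norm of \<open>comm Z (v x)\<close>. It is positive semidefinite, and its kernel corresponds to
  the matrices in \<open>E_space T\<close> that commute with \<open>Z\<close>.\<close>

lemma R30_nonneg_and_zero:
  assumes "reflection_matrix T"
  shows "0 \<le> R30 T Z" "R30 T Z = 0 \<longleftrightarrow> (\<exists>Q\<in>E_space T. Q \<noteq> 0 \<and> comm Z Q = 0)"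
proof -
  obtain Q :: "15 \<Rightarrow> mat7" where Q: "frob_onb Q (E_space T)"
    using obtain_frob_onb_E_space[OF assms] .
  define v where "v = (\<lambda>x :: real^15. \<Sum>i\<in>UNIV. x $ i *\<^sub>R Q i)"
  have row: "(gram Z Q *v x) $ i = inner (comm Z (Q i)) (comm Z (v x))" for x i
    by (simp add: v_def comm_sum gram_def frob_inner matrix_vector_mult_def inner_sum_right mult.commute)
  have quad: "inner x (gram Z Q *v x) = inner (comm Z (v x)) (comm Z (v x))" for x
  proof -
    have "inner x (gram Z Q *v x) = inner (\<Sum>i\<in>UNIV. x $ i *\<^sub>R comm Z (Q i)) (comm Z (v x))"
      by (simp add: inner_vec_def[of x] row inner_sum_left)
    then show ?thesis
      by (simp add: v_def comm_sum)
  qed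
  show "0 \<le> R30 T Z"
    unfolding R30_eq[OF Q] by (rule det_nonneg_of_psd) (simp add: quad)
  have ker: "gram Z Q *v x = 0 \<longleftrightarrow> comm Z (v x) = 0" for x
  proof
    assume "gram Z Q *v x = 0"
    then show "comm Z (v x) = 0" using quad[of x] by simp
  next
    assume "comm Z (v x) = 0"
    then show "gram Z Q *v x = 0" by (simp add: vec_eq_iff[of "gram Z Q *v x"] row)
  qed
  have v0: "v x = 0 \<longleftrightarrow> x = 0" for x
  proof
    assume "v x = 0"
    have "x $ i = inner (Q i) (v x)" for i
    proof -
      have "inner (Q i) (v x) = (\<Sum>j\<in>UNIV. if i = j then x $ j else 0)"
        unfolding v_def inner_sum_right using Q
        by (intro sum.cong) (auto simp: frob_onb_def frob_inner)
      then show ?thesis by simp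
    qed
    then show "x = 0"
      using \<open>v x = 0\<close> by (simp add: vec_eq_iff)
  qed (simp add: v_def)
  have "range v = E_space T"
  proof
    have "v x \<in> span (range Q)" for x
      unfolding v_def by (intro span_sum span_scale span_base) simp
    then show "range v \<subseteq> E_space T"
      using Q by (auto simp: frob_onb_def)
    show "E_space T \<subseteq> range v"
    proof
      fix X assume "X \<in> E_space T"
      then have "X = v (\<chi> i. inner (Q i) X)"
        using frob_onb_expand[OF Q] by (simp add: v_def)
      then show "X \<in> range v" by blast
    qed
  qed
  then show "R30 T Z = 0 \<longleftrightarrow> (\<exists>Q\<in>E_space T. Q \<noteq> 0 \<and> comm Z Q = 0)"
    unfolding R30_eq[OF Q] det_zero_kernel ker by (metis (no_types, lifting) imageE rangeI v0)
qed

section \<open>Quaternionic reflections and octonion derivations\<close>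

lemma matrix_eq_inner:
  fixes A B :: "real^'n^'n"
  assumes "\<And>u v. inner (A *v u) v = inner (B *v u) v"
  shows "A = B"
  by (metis assms matrix_eq vector_eq_rdot)

lemma minus_matrix_vector: "(- A) *v x = - (A *v x)" for A :: "'a::ring_1^'n^'m"
  by (simp add: matrix_vector_mult_def vec_eq_iff sum_negf)

lemma inner_matrix_vector:
  fixes A :: "real^'n^'n"
  shows "inner (A *v u) v = inner u (transpose A *v v)"
  by (metis dot_lmul_matrix inner_commute transpose_matrix_vector)

lemma trace_eq_sum_Basis:
  fixes A :: "real^'n^'n"
  shows "trace A = (\<Sum>e\<in>Basis. inner e (A *v e))"
proof -
  have "bij_betw (\<lambda>i. axis i 1) UNIV (Basis :: (real^'n) set)"
    by (auto simp: bij_betw_def inj_on_def axis_eq_axis Basis_vec_def)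
  then have "(\<Sum>e\<in>Basis. inner e (A *v e)) = (\<Sum>i\<in>UNIV. inner (axis i 1) (A *v axis i 1))"
    by (rule sum.reindex_bij_betw[symmetric])
  also have "\<dots> = trace A"
    by (simp add: inner_axis' matrix_vector_mult_basis column_def trace_def)
  finally show ?thesis by simp
qed

text \<open>The splitting of the octonions into \<open>H\<close> and its orthogonal complement shows
  that \<open>\<sigma>\<close> is a self-adjoint involution, and both properties restrict to
  \<open>T\<close>. The trace comes from the projection \<open>(I + \<sigma>) / 2\<close> onto
  \<open>H\<close>, whose rank is 4.\<close>

lemma quaternionic_reflection_matrix:
  assumes "T \<in> \<C>"
  shows "reflection_matrix T"
proof -
  obtain H \<sigma> where H: "quaternionic_context H" and \<sigma>: "linear \<sigma>"
    "\<And>x. x \<in> H \<Longrightarrow> \<sigma> x = x" "\<And>x. x \<in> H\<^sup>\<bottom> \<Longrightarrow> \<sigma> x = - x" and act: "\<And>v. \<sigma> (0, v) = (0, T *v v)"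
    using assms by (auto simp: quaternionic_reflections_def is_quaternionic_reflection_def acts_on_Im_def)
  have sub: "subspace H" and one: "(1, 0) \<in> H"
    using H by (auto simp: quaternionic_context_def oct_one_def)
  obtain \<phi> :: "quaternion \<Rightarrow> octonion" where \<phi>: "linear \<phi>" "bij_betw \<phi> UNIV H"
    using H by (auto simp: quaternionic_context_def)
  then have "dim H = dim (UNIV :: quaternion set)"
    by (metis bij_betw_def dim_image_eq span_UNIV)
  then have dimH: "dim H = 4"
    by (simp add: dim_UNIV)
  have decomp: "\<exists>h k. h \<in> H \<and> k \<in> H\<^sup>\<bottom> \<and> x = h + k" for x
    using subspace_sum_orthogonal_comp[OF sub] by (metis UNIV_I set_plus_elim)
  have orth: "inner h k = 0" "inner k h = 0" if "h \<in> H" "k \<in> H\<^sup>\<bottom>" for h k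
    using that by (auto simp: orthogonal_comp_def orthogonal_def inner_commute)
  have \<sigma>hk: "\<sigma> (h + k) = h - k" if "h \<in> H" "k \<in> H\<^sup>\<bottom>" for h k
    using that \<sigma> by (simp add: linear_add)
  have sa: "inner (\<sigma> x) y = inner x (\<sigma> y)" for x y
  proof -
    obtain h k h' k' where "h \<in> H" "k \<in> H\<^sup>\<bottom>" "x = h + k" "h' \<in> H" "k' \<in> H\<^sup>\<bottom>" "y = h' + k'"
      using decomp[of x] decomp[of y] by blast
    then show ?thesis
      by (simp add: \<sigma>hk inner_add_left inner_add_right inner_diff_left inner_diff_right orth)
  qed
  have inv: "\<sigma> (\<sigma> x) = x" for x
  proof -
    obtain h k where "h \<in> H" "k \<in> H\<^sup>\<bottom>" "x = h + k"
      using decomp[of x] by blast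
    then show ?thesis
      using \<sigma> by (simp add: \<sigma>hk linear_diff)
  qed
  have "inner (T *v u) v = inner u (T *v v)" for u v
    using sa[of "(0, u)" "(0, v)"] by (simp add: act)
  then have "transpose T = T"
    by (intro matrix_eq_inner)
      (simp add: inner_matrix_vector[of "transpose T"] del: transpose_matrix_vector)
  moreover have "T *v (T *v v) = v" for v
    using inv[of "(0, v)"] by (simp add: act)
  then have "T ** T = mat 1"
    by (simp add: matrix_eq matrix_vector_mul_assoc[symmetric])
  moreover have "trace T = - 1"
  proof -
    define P where "P = (\<lambda>x. (1/2) *\<^sub>R (x + \<sigma> x))"
    have sum_octonion: "sum f Basis = f (1, 0) + (\<Sum>v\<in>Basis. f (0, v))" for f :: "octonion \<Rightarrow> real"
      unfolding Basis_prod_def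
      by (subst sum.union_disjoint) (auto simp: sum.reindex inj_on_def)
    have "real (dim H) = (\<Sum>e\<in>Basis. inner e (P e))"
    proof (rule dim_eq_trace_projection[OF sub])
      fix x y
      obtain h k where hk: "h \<in> H" "k \<in> H\<^sup>\<bottom>" "x = h + k"
        using decomp[of x] by blast
      then have "P x = (1/2) *\<^sub>R (h + h)"
        by (simp add: P_def \<sigma>hk)
      then show "P x \<in> H"
        using hk(1) by (simp add: scaleR_2[symmetric])
      show "P x = x" if "x \<in> H"
        using \<sigma>(2)[OF that] by (simp add: P_def scaleR_2[symmetric])
      show "inner (P x) y = inner x (P y)"
        by (simp add: P_def inner_add_left inner_add_right sa)
    qed
    \<comment> \<open>The unit lies in \<open>H\<close> and contributes 1. The imaginary directions
      contribute \<open>(7 + trace T) / 2\<close>, so rank 4 means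
      \<open>trace T = - 1\<close>.\<close>
    also have "\<dots> = 1 + (\<Sum>v\<in>Basis. inner v (v + T *v v)) / 2"
      using \<sigma>(2)[OF one]
      by (simp add: sum_octonion P_def act inner_add_right sum_divide_distrib)
    also have "(\<Sum>v\<in>Basis. inner v (v + T *v v)) = 7 + trace T"
      by (simp add: inner_add_right sum.distrib trace_eq_sum_Basis)
    finally show ?thesis
      using dimH by simp
  qed
  ultimately show ?thesis
    by (simp add: reflection_matrix_def)
qed

text \<open>A derivation kills the unit, so all its values are imaginary. The real part of the
  product of imaginary \<open>u\<close> and \<open>v\<close> is \<open>- inner u v\<close>, and the
  real part of the Leibniz rule for this product is the skewness of \<open>Z\<close>.\<close>

lemma g2_skew:
  assumes "Z \<in> g2"
  shows "transpose Z = - Z"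
proof -
  obtain D where D: "linear D" "\<And>x y. D (x \<star> y) = D x \<star> y + x \<star> D y"
    and act: "\<And>v. D (0, v) = (0, Z *v v)"
    using assms by (auto simp: g2_def octonion_derivation_def acts_on_Im_def)
  have unit: "x \<star> oct_one = x" "oct_one \<star> x = x" for x
    by (auto simp: oct_mult_def im_mult_def oct_one_def cross7_def prod_eq_iff vec_eq_iff)
  have D1: "D oct_one = 0"
    using D(2)[of oct_one oct_one] by (simp add: unit)
  have fst0: "fst (D x) = 0" for x
  proof -
    have "x = fst x *\<^sub>R oct_one + (0, snd x)"
      by (simp add: oct_one_def prod_eq_iff)
    then have "D x = fst x *\<^sub>R D oct_one + D (0, snd x)"
      by (metis D(1) linear_add linear_cmul)
    then show ?thesis
      by (simp add: D1 act)
  qed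
  have "inner (Z *v u) v + inner u (Z *v v) = 0" for u v
  proof -
    have "fst (D ((0, u) \<star> (0, v))) = - (inner (Z *v u) v + inner u (Z *v v))"
      by (simp add: D(2) act) (simp add: oct_mult_def im_mult_def)
    then show ?thesis
      by (simp add: fst0)
  qed
  then have "inner (transpose Z *v u) v = inner ((- Z) *v u) v" for u v
    by (simp add: inner_matrix_vector[of "transpose Z"] minus_matrix_vector eq_neg_iff_add_eq_0
        add.commute del: transpose_matrix_vector)
  then show ?thesis
    by (rule matrix_eq_inner)
qed

section \<open>Reducibility\<close>

text \<open>By minimality of the hull, commutation with \<open>Q\<close> then only has to be checked
  on the generators \<open>Z\<close> and \<open>TZT\<close>.\<close>

lemma lie_subalgebra_commutant: "lie_subalgebra {A. A ** Q = Q ** A}"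
proof -
  have "comm A B ** Q = Q ** comm A B" if "A ** Q = Q ** A" "B ** Q = Q ** B" for A B
  proof -
    have "A ** B ** Q = Q ** A ** B" "B ** A ** Q = Q ** B ** A"
      using that by (metis matrix_mul_assoc)+
    then show ?thesis
      by (simp add: comm_def matrix_algebra matrix_mul_assoc)
  qed
  then show ?thesis
    by (auto simp: lie_subalgebra_def subspace_def matrix_algebra)
qed

lemma comm_zero_imp_reducible:
  assumes T: "T ** T = mat 1" and Q: "Q \<in> E_space T" "Q \<noteq> 0" "comm Z Q = 0"
  shows "acts_reducibly (Lie {Z, T ** Z ** T})"
proof -
  have ZQ: "Z ** Q = Q ** Z"
    using Q(3) by (simp add: comm_def)
  have "T ** Q ** T = Q" using Q(1) by (simp add: E_space_def)
  then have TQ: "T ** Q = Q ** T"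
    using involution_cancel(2)[OF T] by metis
  have "T ** Z ** T ** Q = Q ** (T ** Z ** T)"
    using TQ ZQ by (metis matrix_mul_assoc)
  then have sub: "Lie {Z, T ** Z ** T} \<subseteq> {A. A ** Q = Q ** A}"
    unfolding Lie_def using ZQ lie_subalgebra_commutant by (intro hull_minimal) auto
  obtain c x where x: "x \<noteq> 0" "Q *v x = c *\<^sub>R x"
  proof -
    have "odd CARD(7)" by simp
    then show thesis
      using odd_dimension_eigenvalue[of Q] that by blast
  qed
  define W where "W = {w. Q *v w = c *\<^sub>R w}"
  have "subspace W"
    by (auto simp: W_def subspace_def algebra_simps matrix_vector_mult_scaleR)
  moreover have "W \<noteq> {0}"
    using x by (auto simp: W_def)
  \<comment> \<open>If the eigenspace were everything, \<open>Q\<close> would be scalar, and a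
    traceless scalar matrix vanishes.\<close>
  moreover have "W \<noteq> UNIV"
  proof
    assume "W = UNIV"
    then have "Q *v w = c *\<^sub>R w" for w
      by (auto simp: W_def)
    then have "Q = c *\<^sub>R mat 1"
      by (simp add: matrix_eq scaleR_matrix_vector_assoc[symmetric])
    moreover have "trace Q = 0"
      using Q(1) by (simp add: E_space_def S0_def)
    ultimately show False
      using Q(2) by (simp add: trace_scaleR trace_I)
  qed
  moreover have "A *v w \<in> W" if "A \<in> Lie {Z, T ** Z ** T}" "w \<in> W" for A w
  proof -
    have "Q *v (A *v w) = A *v (Q *v w)"
      using sub that(1) by (auto simp: matrix_vector_mul_assoc)
    then show ?thesis
      using that(2) by (simp add: W_def matrix_vector_mult_scaleR)
  qed
  ultimately show ?thesis
    unfolding acts_reducibly_def by blast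
qed

lemma reducible_imp_comm_zero:
  assumes T: "reflection_matrix T" and Z: "transpose Z = - Z" and red: "acts_reducibly (Lie {Z, T ** Z ** T})"
  shows "\<exists>Q\<in>E_space T. Q \<noteq> 0 \<and> comm Z Q = 0"
proof -
  note Ts = reflection_matrixD(1)[OF T] and TT = reflection_matrixD(2)[OF T]
  obtain W where W: "subspace W" "W \<noteq> {0}" "W \<noteq> UNIV"
    and inv: "\<And>A w. A \<in> Lie {Z, T ** Z ** T} \<Longrightarrow> w \<in> W \<Longrightarrow> A *v w \<in> W"
    using red unfolding acts_reducibly_def by blast
  obtain P where P: "transpose P = P" "\<And>x. P *v x \<in> W" "\<And>x. x \<in> W \<Longrightarrow> P *v x = x"
    using matrix_projection_exists[OF W(1)] by blast
  have PP: "P ** P = P"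
    by (simp add: matrix_eq matrix_vector_mul_assoc[symmetric] P)
  \<comment> \<open>Invariance of \<open>W\<close> gives \<open>PAP = AP\<close>; transposing this
    for skew \<open>A\<close> gives \<open>PAP = PA\<close>. Equivalently, the orthogonal complement
    of \<open>W\<close> is invariant too.\<close>
  have commute: "A ** P = P ** A" if "A \<in> Lie {Z, T ** Z ** T}" "transpose A = - A" for A
  proof -
    have "P ** A ** P = A ** P"
      by (simp add: matrix_eq matrix_vector_mul_assoc[symmetric] P inv that(1))
    moreover from this have "transpose (P ** A ** P) = transpose (A ** P)"
      by simp
    then have "P ** A ** P = P ** A"
      by (simp add: matrix_transpose_mul P(1) that(2) matrix_minus_left matrix_minus_right matrix_mul_assoc)
    ultimately show ?thesis by simp
  qed
  have mem: "{Z, T ** Z ** T} \<subseteq> Lie {Z, T ** Z ** T}"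
    unfolding Lie_def by (rule hull_subset)
  have ZP: "Z ** P = P ** Z"
    using mem commute Z by auto
  have "transpose (T ** Z ** T) = - (T ** Z ** T)"
    by (simp add: matrix_transpose_mul Ts Z matrix_minus_left matrix_minus_right matrix_mul_assoc)
  then have ZTP: "T ** Z ** T ** P = P ** (T ** Z ** T)"
    using mem commute by blast
  let ?R = "T ** P ** T"
  \<comment> \<open>This is the commutation of \<open>TZT\<close> with \<open>P\<close>, conjugated
    by \<open>T\<close>; it is why both generators of the Lie algebra are required to preserve
    \<open>W\<close>.\<close>
  have ZR: "Z ** ?R = ?R ** Z"
  proof -
    have "Z ** ?R = T ** (T ** Z ** T ** P) ** T"
      by (simp add: matrix_mul_assoc TT)
    also have "\<dots> = ?R ** Z"
      by (simp add: ZTP matrix_mul_assoc involution_cancel(2)[OF TT])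
    finally show ?thesis .
  qed
  \<comment> \<open>The value that makes \<open>Q\<close> traceless, since \<open>P\<close> and
    \<open>TPT\<close> have equal traces.\<close>
  define c where "c = 2 * trace P / 7"
  define Q where "Q = P + ?R - c *\<^sub>R mat 1"
  have "Q \<in> E_space T"
    by (simp add: Q_def E_space_def S0_def matrix_algebra trace_add trace_sub trace_scaleR trace_I
        trace_conj[OF TT] matrix_mul_assoc involution_cancel[OF TT] P(1) Ts TT c_def)
  moreover have "comm Z Q = 0"
    by (simp add: comm_def Q_def matrix_algebra ZP ZR)
  moreover have "Q \<noteq> 0"
  proof
    assume "Q = 0"
    \<comment> \<open>The right side has eigenvalue \<open>c - 1\<close> on \<open>W\<close> and
      \<open>c\<close> on the kernel of \<open>P\<close>, both nonzero subspaces. As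
      \<open>?R\<close> is idempotent, both numbers are 0 or 1, which forces \<open>c = 1\<close>
      and hence the impossible \<open>2 * dim W = 7\<close>.\<close>
    then have R: "?R = c *\<^sub>R mat 1 - P"
      by (simp add: Q_def algebra_simps)
    have RR: "?R ** ?R = ?R"
      by (metis PP TT involution_cancel(2) matrix_mul_assoc)
    obtain w where w: "w \<in> W" "w \<noteq> 0"
      using W(1,2) subspace_0 by blast
    obtain u where u: "u \<notin> W" using W(3) by blast
    define v where "v = u - P *v u"
    have v: "v \<noteq> 0" "P *v v = 0"
      using u P(2)[of u] P(3)[OF P(2), of u]
      by (metis v_def eq_iff_diff_eq_0, simp add: v_def matrix_vector_mult_diff_distrib)
    have "?R *v w = (c - 1) *\<^sub>R w" "?R *v v = c *\<^sub>R v"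
      using w v P(3)[of w] unfolding R
      by (simp_all add: matrix_vector_mult_diff_rdistrib scaleR_matrix_vector_assoc[symmetric] scaleR_diff_left)
    moreover have "?R *v (?R *v y) = ?R *v y" for y
      by (simp only: matrix_vector_mul_assoc RR)
    ultimately have "(c - 1) * (c - 1) = c - 1" "c * c = c"
      using w v by (metis matrix_vector_mult_scaleR scaleR_cancel_right scaleR_scaleR)+
    then have "c = 1" by (simp add: algebra_simps)
    moreover have "trace P = real (dim W)"
      unfolding trace_eq_sum_Basis
      by (rule dim_eq_trace_projection[OF W(1) P(2,3), symmetric]) (simp_all add: inner_matrix_vector P(1))
    ultimately have "2 * real (dim W) = 7"
      by (simp add: c_def)
    then have "2 * dim W = 7" by linarith
    then show False by presburger
  qed
  ultimately show ?thesis by blast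
qed

section \<open>Homogeneity, invariance and polynomiality\<close>

text \<open>The basis depends on \<open>T\<close> alone and each Gram entry is quadratic in
  \<open>Z\<close>, so the 15 by 15 determinant scales with exponent \<open>2 * 15\<close>.\<close>

lemma R30_scaleR:
  assumes "reflection_matrix T"
  shows "R30 T (c *\<^sub>R Z) = c ^ 30 * R30 T Z"
proof -
  obtain Q :: "15 \<Rightarrow> mat7" where Q: "frob_onb Q (E_space T)"
    using obtain_frob_onb_E_space[OF assms] .
  have "comm (c *\<^sub>R Z) U = c *\<^sub>R comm Z U" for U
    by (simp add: comm_def matrix_algebra scaleR_diff_right)
  then have "gram (c *\<^sub>R Z) Q $ i $ j = (c * c) * gram Z Q $ i $ j" for i j
    by (simp add: gram_def frob_inner mult.assoc)
  then have "gram (c *\<^sub>R Z) Q = (c * c) *\<^sub>R gram Z Q"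
    by (simp add: vec_eq_iff)
  then show ?thesis
    by (simp add: R30_eq[OF Q] det_scaleR power2_eq_square[symmetric] power_mult[symmetric])
qed

section \<open>Simultaneous orthogonal conjugation\<close>

lemma orthogonal_matrix_inv: "matrix_inv g = transpose g" if "orthogonal_matrix g" for g :: "real^'n^'n"
proof -
  have g: "g ** transpose g = mat 1" "transpose g ** g = mat 1"
    using that by (auto simp: orthogonal_matrix_def)
  then have "\<exists>A'. g ** A' = mat 1 \<and> A' ** g = mat 1" by blast
  then have "g ** matrix_inv g = mat 1"
    unfolding matrix_inv_def by (rule someI2_ex) blast
  then have "transpose g ** (g ** matrix_inv g) = transpose g" by simp
  then show ?thesis
    by (simp add: matrix_mul_assoc g(2))
qed

lemma conj_mult:
  fixes g :: "real^'n^'n"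
  assumes "transpose g ** g = mat 1"
  shows "(g ** A ** transpose g) ** (g ** B ** transpose g) = g ** (A ** B) ** transpose g"
proof -
  have "(g ** A ** transpose g) ** (g ** B ** transpose g)
      = g ** A ** (transpose g ** g) ** B ** transpose g"
    by (simp only: matrix_mul_assoc)
  then show ?thesis
    by (simp add: assms matrix_mul_assoc)
qed

lemma trace_orthogonal_conj:
  fixes g A :: "real^'n^'n"
  assumes "transpose g ** g = mat 1"
  shows "trace (g ** A ** transpose g) = trace A"
proof -
  have "trace (g ** A ** transpose g) = trace (transpose g ** (g ** A))"
    by (rule trace_mul_sym)
  then show ?thesis by (simp add: matrix_mul_assoc assms)
qed

lemma transpose_conj:
  fixes g A :: "real^'n^'n"
  shows "transpose (g ** A ** transpose g) = g ** transpose A ** transpose g"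
  by (simp add: matrix_transpose_mul matrix_mul_assoc)

lemma reflection_matrix_conj:
  assumes "reflection_matrix T" "transpose g ** g = mat 1" "g ** transpose g = mat 1"
  shows "reflection_matrix (g ** T ** transpose g)"
  using assms(1,3)
  by (simp add: reflection_matrix_def conj_mult[OF assms(2)] trace_orthogonal_conj[OF assms(2)] transpose_conj)

lemma skew_conj:
  fixes g Z :: "real^'n^'n"
  assumes "transpose Z = - Z"
  shows "transpose (g ** Z ** transpose g) = - (g ** Z ** transpose g)"
  by (simp add: transpose_conj assms matrix_minus_left matrix_minus_right)

text \<open>Conjugation by \<open>g\<close> is a Frobenius isometry, respects brackets and carries
  \<open>E_space T\<close> onto the space of the conjugated \<open>T\<close>. A conjugated
  orthonormal basis therefore has the same Gram matrix.\<close>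

lemma R30_conj:
  assumes T: "reflection_matrix T" and g: "transpose g ** g = mat 1" "g ** transpose g = mat 1"
  shows "R30 (g ** T ** transpose g) (g ** Z ** transpose g) = R30 T Z"
proof -
  let ?c = "\<lambda>A. g ** A ** transpose g"
  obtain Q :: "15 \<Rightarrow> mat7" where Q: "frob_onb Q (E_space T)"
    using obtain_frob_onb_E_space[OF T] .
  have lin: "linear ?c"
    by (rule linearI) (simp_all add: matrix_algebra)
  have inner_c: "inner (?c A) (?c B) = inner A B" for A B
  proof -
    have "inner (?c A) (?c B) = inner A (transpose g ** ?c B ** g)"
      by (simp add: inner_sandwich)
    also have "transpose g ** ?c B ** g = (transpose g ** g) ** B ** (transpose g ** g)"
      by (simp add: matrix_mul_assoc)
    finally show ?thesis by (simp add: g)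
  qed
  have comm_c: "comm (?c A) (?c B) = ?c (comm A B)" for A B
    by (simp add: comm_def conj_mult[OF g(1)] matrix_diff_left matrix_diff_right)
  have sub: "?c A \<in> E_space (?c T)" if "A \<in> E_space T" for A
    using that by (simp add: E_space_def S0_def conj_mult[OF g(1)] trace_orthogonal_conj[OF g(1)]
        transpose_conj)
  have "?c ` E_space T = E_space (?c T)"
  proof
    show "?c ` E_space T \<subseteq> E_space (?c T)"
      using sub by auto
    show "E_space (?c T) \<subseteq> ?c ` E_space T"
    proof
      fix B assume B: "B \<in> E_space (?c T)"
      let ?A = "transpose g ** B ** g"
      have Bc: "?c ?A = B"
      proof -
        have "?c ?A = (g ** transpose g) ** B ** (g ** transpose g)"
          by (simp only: matrix_mul_assoc)
        then show ?thesis by (simp add: g)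
      qed
      have *: "A = transpose g ** ?c A ** g" for A
      proof -
        have "transpose g ** ?c A ** g = (transpose g ** g) ** A ** (transpose g ** g)"
          by (simp only: matrix_mul_assoc)
        then show ?thesis by (simp add: g)
      qed
      have "?c T ** ?c ?A ** ?c T = ?c ?A"
        unfolding Bc using B by (simp add: E_space_def)
      then have "?c (T ** ?A ** T) = ?c ?A"
        by (simp only: conj_mult[OF g(1)])
      then have "T ** ?A ** T = ?A" using * by metis
      moreover have "trace ?A = 0"
        using B trace_orthogonal_conj[OF g(1), of ?A] unfolding Bc by (simp add: E_space_def S0_def)
      moreover have "transpose ?A = ?A"
        using B by (simp add: E_space_def S0_def matrix_transpose_mul matrix_mul_assoc)
      ultimately have "?A \<in> E_space T"
        by (simp add: E_space_def S0_def)
      then show "B \<in> ?c ` E_space T"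
        using Bc by (metis imageI)
    qed
  qed
  then have Qc: "frob_onb (\<lambda>i. ?c (Q i)) (E_space (?c T))"
    using Q linear_span_image[OF lin, of "range Q"]
    by (simp add: frob_onb_def frob_inner inner_c image_image)
  show ?thesis
    by (simp add: R30_eq[OF Qc] R30_eq[OF Q] gram_def comm_c frob_inner inner_c)
qed

section \<open>Polynomial dependence on the matrix entries\<close>

definition polynomial_matrix :: "('a::real_normed_vector \<Rightarrow> mat7) \<Rightarrow> bool" where
  "polynomial_matrix F \<longleftrightarrow> (\<forall>i j. real_polynomial_function (\<lambda>x. F x $ i $ j))"

lemma polynomial_matrix_intros:
  "polynomial_matrix (\<lambda>x. C)"
  "polynomial_matrix F \<Longrightarrow> polynomial_matrix G \<Longrightarrow> polynomial_matrix (\<lambda>x. F x + G x)"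
  "polynomial_matrix F \<Longrightarrow> polynomial_matrix G \<Longrightarrow> polynomial_matrix (\<lambda>x. F x - G x)"
  "polynomial_matrix F \<Longrightarrow> polynomial_matrix (\<lambda>x. c *\<^sub>R F x)"
  "polynomial_matrix F \<Longrightarrow> polynomial_matrix G \<Longrightarrow> polynomial_matrix (\<lambda>x. F x ** G x)"
  unfolding polynomial_matrix_def matrix_matrix_mult_def
  by (auto intro!: real_polynomial_function_sum real_polynomial_function.intros(4))

text \<open>Entries of a bounded linear matrix-valued map are bounded linear functionals, the
  generators of \<open>real_polynomial_function\<close>. This covers the projections from
  \<open>(T, Z)\<close> to \<open>T\<close> and to \<open>Z\<close>.\<close>

lemma polynomial_matrix_bounded_linear:
  assumes "bounded_linear F"
  shows "polynomial_matrix F"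
  unfolding polynomial_matrix_def
  using bounded_linear_compose[OF bounded_linear_vec_nth bounded_linear_compose[OF bounded_linear_vec_nth assms]]
  by auto

lemma polynomial_det:
  fixes M :: "'a::real_normed_vector \<Rightarrow> real^'n^'n"
  assumes "\<And>i j. real_polynomial_function (\<lambda>x. M x $ i $ j)"
  shows "real_polynomial_function (\<lambda>x. det (M x))"
  unfolding det_def using assms by (intro real_polynomial_function_sum real_polynomial_function.intros(2,4)
      real_polynomial_function_prod) auto

lemma polynomial_inner:
  assumes "polynomial_matrix F"
  shows "real_polynomial_function (\<lambda>x. inner B (F x))"
  using assms unfolding polynomial_matrix_def inner_vec_def
  by (auto intro!: real_polynomial_function_sum real_polynomial_function.intros(2,4))

lemma polynomial_R30_operator:
  "polynomial_matrix (\<lambda>(T, Z). R30_operator T Z Q)"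
proof -
  have "polynomial_matrix (fst :: mat7 \<times> mat7 \<Rightarrow> mat7)" "polynomial_matrix (snd :: mat7 \<times> mat7 \<Rightarrow> mat7)"
    by (simp_all add: polynomial_matrix_bounded_linear bounded_linear_fst bounded_linear_snd)
  then show ?thesis
    unfolding case_prod_unfold R30_operator_def Pi_plus_def Pi_minus_def comm_def
    by (intro polynomial_matrix_intros)
qed

theorem proposition6p2:
  shows
    "(\<forall>T\<in>\<C>. \<forall>Z\<in>g2.
        R30 T Z \<ge> 0 \<and>
        (\<forall>c::real. R30 T (c *\<^sub>R Z) = c ^ 30 * R30 T Z) \<and>
        (R30 T Z = 0 \<longleftrightarrow> acts_reducibly (Lie {Z, T ** Z ** T})) \<and>
        R30 T Z = det_S0 (R30_operator T Z) \<and>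
        (\<forall>g::mat7. orthogonal_matrix g \<longrightarrow>
           R30 (g ** T ** matrix_inv g) (g ** Z ** matrix_inv g) = R30 T Z \<and>
           det_S0 (R30_operator (g ** T ** matrix_inv g) (g ** Z ** matrix_inv g))
             = det_S0 (R30_operator T Z))) \<and>
     (\<exists>p :: mat7 \<times> mat7 \<Rightarrow> real. real_polynomial_function p \<and>
        (\<forall>T\<in>\<C>. \<forall>Z\<in>g2. R30 T Z = p (T, Z)))"
proof (intro conjI ballI allI impI)
  fix T Z assume "T \<in> \<C>" "Z \<in> g2"
  then have T: "reflection_matrix T" and Z: "transpose Z = - Z"
    by (auto intro: quaternionic_reflection_matrix g2_skew)
  show "R30 T Z \<ge> 0"
    by (rule R30_nonneg_and_zero(1)[OF T])
  show "R30 T (c *\<^sub>R Z) = c ^ 30 * R30 T Z" for c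
    by (rule R30_scaleR[OF T])
  show "R30 T Z = 0 \<longleftrightarrow> acts_reducibly (Lie {Z, T ** Z ** T})"
    using R30_nonneg_and_zero(2)[OF T] reducible_imp_comm_zero[OF T Z]
      comm_zero_imp_reducible[OF reflection_matrixD(2)[OF T]] by blast
  show eq: "R30 T Z = det_S0 (R30_operator T Z)"
    by (rule R30_eq_det_S0[OF T Z])
  fix g :: mat7 assume g: "orthogonal_matrix g"
  then have gg: "transpose g ** g = mat 1" "g ** transpose g = mat 1"
    by (auto simp: orthogonal_matrix_def)
  show conj: "R30 (g ** T ** matrix_inv g) (g ** Z ** matrix_inv g) = R30 T Z"
    unfolding orthogonal_matrix_inv[OF g] by (rule R30_conj[OF T gg])
  \<comment> \<open>The conjugated pair again consists of a \<open>reflection_matrix\<close> and a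
    skew matrix, so the determinant identity holds for it as well and transfers the invariance of
    \<open>R30\<close>.\<close>
  show "det_S0 (R30_operator (g ** T ** matrix_inv g) (g ** Z ** matrix_inv g))
      = det_S0 (R30_operator T Z)"
    using conj eq R30_eq_det_S0[OF reflection_matrix_conj[OF T gg] skew_conj[OF Z, of g]]
    unfolding orthogonal_matrix_inv[OF g] by simp
next
  have "subspace S0"
    by (simp add: S0_eq_E_space subspace_E_space)
  then obtain B :: "27 \<Rightarrow> mat7" where B: "frob_onb B S0"
    using frob_onb_exists[where 'n = 27] dim_S0 by auto
  \<comment> \<open>The Gram formula uses a basis of \<open>E_space T\<close> that varies with
    \<open>T\<close>. The determinant on \<open>S0\<close> uses one basis \<open>B\<close> for all
    \<open>T\<close>, so its matrix entries are visibly polynomial in \<open>(T, Z)\<close>.\<close>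
  let ?p = "\<lambda>x. det (\<chi> i j. inner (B i) ((\<lambda>(T, Z). R30_operator T Z (B j)) x))"
  have "real_polynomial_function ?p"
    by (rule polynomial_det) (simp only: vec_lambda_beta polynomial_inner[OF polynomial_R30_operator])
  moreover have "R30 T Z = ?p (T, Z)" if "T \<in> \<C>" "Z \<in> g2" for T Z
  proof -
    have T: "reflection_matrix T" and Z: "transpose Z = - Z"
      using that by (auto intro: quaternionic_reflection_matrix g2_skew)
    show ?thesis
      using R30_eq_det_S0[OF T Z] det_S0_orthonormal[OF B linear_R30_operator R30_operator_S0[OF T Z]]
      by simp
  qed
  ultimately show "\<exists>p :: mat7 \<times> mat7 \<Rightarrow> real. real_polynomial_function p \<and>
      (\<forall>T\<in>\<C>. \<forall>Z\<in>g2. R30 T Z = p (T, Z))"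
    by blast
qed

end
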